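(* Let $\alpha\in\mathbb{R}$, $N\ge2$, $\mathbf{y}_1,\dots,\mathbf{y}_{N-2}\in\mathbb{R}^2$ arbitrary, $0\le R\le L/6$ with $L>0$, $\kappa\in[0,1]$, and $u\in W^{1,2}([R,L],r\,dr)$. Then $$\int_R^L\Big(|u'|^2+\frac{\rho(r)}{r^2}|u|^2\Big)r\,dr\ge\int_R^L\Big((1-\kappa)|u'|^2+c(\kappa)^2\frac{\alpha_N^2}{r^2}\mathbb{1}_{[3R,L-3R]}(r)|u|^2\Big)r\,dr$$ with $c(\kappa)=4.7\cdot10^{-4}\,\kappa/(1+2\kappa)$. In the case $R=0$ one may take $c(\kappa)\equiv1$.
   Context: For $R>0$ define the normalized flux $\hat\Phi(r)=\alpha\Big(\int_{B_r(0)}\frac{\mathbb{1}_{B_{R/2}(0)}}{\pi(R/2)^2}+2\sum_{l=1}^{N-2}\int_{B_r(0)}\frac{\mathbb{1}_{B_R(\mathbf{y}_l)}}{\pi R^2}\Big)$; for $R=0$ (point fluxes) $\hat\Phi(r)=\alpha\big(1+2\#\{l:|\mathbf{y}_l|<r\}\big)$. Then $\rho(r):=\inf_{q\in\mathbb{Z}}|\hat\Phi(r)-2q|^2$. Also $\alpha_N:=\min_{p\in\{0,\dots,N-2\}}\min_{q\in\mathbb{Z}}|(2p+1)\alpha-2q|$. $B_r(\mathbf{y})$ is the open disk. *)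

theory Defs
  imports "HOL-Analysis.Analysis"
begin

text \<open>Normalized flux. Points y l (l = 1..N-2) lie in the plane real^2.
  For R > 0 the flux is spread uniformly over disks; for R = 0 it is point-like.\<close>
definition Phi_hat :: "real \<Rightarrow> nat \<Rightarrow> (nat \<Rightarrow> real^2) \<Rightarrow> real \<Rightarrow> real \<Rightarrow> real" where
  "Phi_hat \<alpha> N y R r =
    (if R > 0 then
       \<alpha> * ((LINT x:ball 0 r|lborel. indicator (ball (0::real^2) (R/2)) x / (pi * (R/2)^2))
            + 2 * (\<Sum>l = 1..N-2. LINT x:ball 0 r|lborel. indicator (ball (y l) R) x / (pi * R^2)))
     else \<alpha> * (1 + 2 * real (card {l \<in> {1..N-2}. norm (y l) < r})))"

definition rho :: "real \<Rightarrow> nat \<Rightarrow> (nat \<Rightarrow> real^2) \<Rightarrow> real \<Rightarrow> real \<Rightarrow> real" where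
  "rho \<alpha> N y R r = (INF q::int. \<bar>Phi_hat \<alpha> N y R r - 2 * of_int q\<bar>^2)"

definition alphaN :: "real \<Rightarrow> nat \<Rightarrow> real" where
  "alphaN \<alpha> N = Min ((\<lambda>p::nat. INF q::int. \<bar>(2 * real p + 1) * \<alpha> - 2 * of_int q\<bar>) ` {0..N-2})"

definition c_const :: "real \<Rightarrow> real" where
  "c_const \<kappa> = 47 / 100000 * \<kappa> / (1 + 2 * \<kappa>)"

text \<open>u \<in> W^{1,2}([R,L], r dr): u is locally absolutely continuous on (R,L] with
  derivative u' (fundamental theorem of calculus on every [a,b] \<subseteq> (R,L]),
  and u, u' are square integrable with respect to r dr on [R,L].\<close>
definition weighted_W12 :: "real \<Rightarrow> real \<Rightarrow> (real \<Rightarrow> complex) \<Rightarrow> (real \<Rightarrow> complex) \<Rightarrow> bool" where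
  "weighted_W12 R L u u' \<longleftrightarrow>
     (\<forall>a b. R < a \<longrightarrow> a \<le> b \<longrightarrow> b \<le> L \<longrightarrow> (u' has_integral (u b - u a)) {a..b}) \<and>
     set_integrable lborel {R..L} (\<lambda>r. (cmod (u r))^2 * r) \<and>
     set_integrable lborel {R..L} (\<lambda>r. (cmod (u' r))^2 * r)"

end

theory Submission
  imports Defs
begin

text \<open>
  For \<open>R = 0\<close> the flux takes only the values \<open>(2 p + 1) \<alpha>\<close> and the inequality holds pointwise. For
  \<open>R > 0\<close> it suffices, by a Poincare argument on windows of length about \<open>R\<close>, that in each window the
  flux keeps a distance at least \<open>\<alpha>\<^sub>N / 130\<close> from the even integers on a set of measure at least
  \<open>R / 192\<close>.

  The share of a disk covered by \<open>B\<^sub>r(0)\<close> is, as a function of \<open>v = r\<^sup>2\<close>, first convex and then concave,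
  with the inflection at \<open>v = |y|\<^sup>2 - R\<^sup>2\<close>: dilations of the plane preserve area per unit of \<open>v\<close> and map the
  disk into itself in the relevant range. Hence on a short interval the flux is the sum of a convex
  part, a concave part and a part with bounded slope ratio. Splitting at the minimum of the difference
  of the first two, the slopes are monotone up to a constant on either side, so after the first passage
  near an even integer the flux crosses each gap between two even integers at least as slowly, up to a
  constant, as it passes the next even integer. If it nevertheless avoids the gaps, it stays near a
  single even integer for a length of \<open>R / 16\<close>. Then it is almost constant there, so each disk is either
  almost covered or almost uncovered, and the flux is close to some \<open>(2 p + 1) \<alpha>\<close>, contradicting the
  definition of \<open>\<alpha>\<^sub>N\<close>.
\<close>

section \<open>Convexity and slopes\<close>

text \<open>\<open>scal\<close> says that the average slope does not decrease from
  \<open>[v / \<mu>, v]\<close> to \<open>[v, v * \<mu>]\<close>, an interval \<open>\<mu>\<close>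
  times as long. If \<open>F\<close> rose above a chord, this would fail at the last maximum of
  \<open>F\<close> minus the chord.\<close>

lemma convex_on_of_scaling:
  fixes F :: "real \<Rightarrow> real"
  assumes I: "convex I" "\<And>v. v \<in> I \<Longrightarrow> 0 < v"
    and cont: "continuous_on I F"
    and scal: "\<And>v \<mu>. 1 < \<mu> \<Longrightarrow> v / \<mu> \<in> I \<Longrightarrow> v * \<mu> \<in> I \<Longrightarrow> \<mu> * (F v - F (v / \<mu>)) \<le> F (v * \<mu>) - F v"
  shows "convex_on I F"
proof (rule convex_on_linorderI)
  fix t x y :: real
  assume t: "0 < t" "t < 1" and xy: "x \<in> I" "y \<in> I" "x < y"
  define s where "s = (F y - F x) / (y - x)"
  define P where "P = (\<lambda>z. F z - (F x + (z - x) * s))"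
  have sub: "{x..y} \<subseteq> I"
    using closed_segment_subset[OF xy(1,2) I(1)] xy(3) by (simp add: closed_segment_eq_real_ivl1)
  have contP: "continuous_on {x..y} P"
    unfolding P_def by (intro continuous_intros continuous_on_subset[OF cont sub])
  have Pxy: "P x = 0" "P y = 0" using xy by (auto simp: P_def s_def)
  obtain m0 where m0: "m0 \<in> {x..y}" "\<And>z. z \<in> {x..y} \<Longrightarrow> P z \<le> P m0"
    using continuous_attains_sup[OF compact_Icc _ contP] xy(3) by force
  have "P m0 \<le> 0"
  proof (rule ccontr)
    assume "\<not> P m0 \<le> 0"
    then have pos: "0 < P m0" by simp
    \<comment> \<open>The largest maximiser \<open>c\<close> is taken so that the comparison to its
      right is strict.\<close>
    define K where "K = {z \<in> {x..y}. P z = P m0}"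
    have "closed K"
      unfolding K_def by (rule continuous_closed_preimage_constant[OF contP]) simp
    moreover have "bounded K"
      by (rule bounded_subset[OF bounded_closed_interval[of x y]]) (auto simp: K_def)
    ultimately have "compact K" by (simp add: compact_eq_bounded_closed)
    moreover have "K \<noteq> {}" using m0(1) by (auto simp: K_def)
    ultimately obtain c where c: "c \<in> K" "\<And>z. z \<in> K \<Longrightarrow> z \<le> c"
      using compact_attains_sup[of K] by blast
    have cK: "c \<in> {x..y}" "P c = P m0" using c(1) by (auto simp: K_def)
    have "c \<noteq> x" "c \<noteq> y" using cK(2) pos Pxy by (metis less_irrefl)+
    then have cx: "x < c" "c < y" using cK(1) by auto
    have x0: "0 < x" using I(2) xy by blast
    \<comment> \<open>The largest factor for which both \<open>c / \<mu>\<close> and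
      \<open>c * \<mu>\<close> stay in \<open>[x, y]\<close>.\<close>
    define \<mu> where "\<mu> = min (c / x) (y / c)"
    have mu: "1 < \<mu>" "x \<le> c / \<mu>" "c * \<mu> \<le> y"
    proof -
      show "1 < \<mu>" using cx x0 by (simp add: \<mu>_def)
      have "\<mu> \<le> c / x" "\<mu> \<le> y / c" by (auto simp: \<mu>_def)
      then have "\<mu> * x \<le> c" "\<mu> * c \<le> y" using cx x0 by (simp_all add: pos_le_divide_eq)
      then show "x \<le> c / \<mu>" "c * \<mu> \<le> y"
        using \<open>1 < \<mu>\<close> by (simp_all add: pos_le_divide_eq mult.commute)
    qed
    have c0: "0 < c" using cx x0 by simp
    have lt: "c / \<mu> < c" "c < c * \<mu>" using mu(1) c0 by (simp_all add: pos_divide_less_eq)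
    have inD: "c / \<mu> \<in> {x..y}" "c * \<mu> \<in> {x..y}" using mu lt cx by auto
    have "c * \<mu> \<notin> K" using c(2) lt by force
    then have "P (c * \<mu>) \<noteq> P m0" using inD(2) by (simp add: K_def)
    then have "P (c * \<mu>) < P c" using m0(2)[OF inD(2)] cK(2) by linarith
    then have 1: "F (c * \<mu>) - F c < (c * \<mu> - c) * s" unfolding P_def by argo
    have "P (c / \<mu>) \<le> P c" using m0(2)[OF inD(1)] cK(2) by linarith
    then have 2: "(c - c / \<mu>) * s \<le> F c - F (c / \<mu>)" unfolding P_def by argo
    have "\<mu> * ((c - c / \<mu>) * s) \<le> \<mu> * (F c - F (c / \<mu>))" using 2 mu(1) by simp
    also have "\<dots> \<le> F (c * \<mu>) - F c" using scal[OF mu(1)] inD sub by blast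
    also have "\<dots> < (c * \<mu> - c) * s" by (rule 1)
    also have "(c * \<mu> - c) * s = \<mu> * (c - c / \<mu>) * s" using mu(1) by (simp add: right_diff_distrib)
    also have "\<dots> = \<mu> * ((c - c / \<mu>) * s)" by simp
    finally show False by simp
  qed
  moreover have "(1 - t) *\<^sub>R x + t *\<^sub>R y \<in> {x..y}"
    using t xy mult_left_mono[of x y t] mult_left_mono[of x y "1-t"] by (auto simp: algebra_simps)
  ultimately have "P ((1 - t) *\<^sub>R x + t *\<^sub>R y) \<le> 0" using m0(2) by force
  moreover have "((1 - t) *\<^sub>R x + t *\<^sub>R y - x) * s = t * ((y - x) * s)"
    by (simp add: algebra_simps)
  moreover have "(y - x) * s = F y - F x" using xy(3) by (simp add: s_def)
  ultimately have "F ((1 - t) *\<^sub>R x + t *\<^sub>R y) - (F x + t * (F y - F x)) \<le> 0"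
    unfolding P_def by simp
  then show "F ((1 - t) *\<^sub>R x + t *\<^sub>R y) \<le> (1 - t) * F x + t * F y"
    by (simp add: left_diff_distrib right_diff_distrib)
qed (rule I(1))

text \<open>Average slopes grow from an interval to a later one; products in place of quotients
  admit degenerate intervals. For \<open>y < z\<close> both slopes are compared with the one over
  \<open>[y, z]\<close>.\<close>

lemma convex_on_slopes:
  fixes F :: "real \<Rightarrow> real"
  assumes "convex_on I F" "x \<in> I" "w \<in> I" "x \<le> y" "y \<le> z" "z \<le> w"
  shows "(F y - F x) * (w - z) \<le> (F w - F z) * (y - x)"
proof -
  have three: "(F b - F a) * (c - b) \<le> (F c - F b) * (b - a)"
    if "a \<in> I" "c \<in> I" "a \<le> b" "b \<le> c" for a b c
  proof (cases "a = c")
    case False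
    then have ac: "a < c" using that by simp
    define t where "t = (b - a) / (c - a)"
    have tc: "t * (c - a) = b - a" using ac by (simp add: t_def)
    then have tb: "(1 - t) *\<^sub>R a + t *\<^sub>R c = b" by (simp add: algebra_simps)
    have t: "0 \<le> t" "t \<le> 1" using ac that by (auto simp: t_def)
    have "F b \<le> (1 - t) * F a + t * F c"
      using convex_onD[OF assms(1) t(1,2) that(1,2)] tb by simp
    then have "(c - a) * F b \<le> (c - a) * ((1 - t) * F a + t * F c)"
      using ac by (intro mult_left_mono) auto
    also have "\<dots> = ((c - a) - t * (c - a)) * F a + (t * (c - a)) * F c"
      by (simp add: algebra_simps)
    also note tc
    finally show ?thesis by (simp add: algebra_simps)
  qed (use that in auto)
  have I: "y \<in> I" "z \<in> I"
    using convex_on_imp_convex[OF assms(1)] assms(2-6) mem_is_interval_1_I[of I x w]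
    by (auto simp: is_interval_convex_1)
  show ?thesis
  proof (cases "y = z")
    case True
    then show ?thesis using three[of x w y] assms by simp
  next
    case False
    then have yz: "y < z" using assms by simp
    have "(F y - F x) * (z - y) \<le> (F z - F y) * (y - x)" using three I assms by simp
    then have "((F y - F x) * (z - y)) * (w - z) \<le> ((F z - F y) * (y - x)) * (w - z)"
      using assms by (intro mult_right_mono) auto
    also have "\<dots> = ((F z - F y) * (w - z)) * (y - x)" by simp
    also have "\<dots> \<le> ((F w - F z) * (z - y)) * (y - x)"
      using three I assms by (intro mult_right_mono) auto
    finally have "(z - y) * ((F y - F x) * (w - z)) \<le> (z - y) * ((F w - F z) * (y - x))"
      by (simp add: mult_ac)
    then show ?thesis using yz by simp
  qed
qed

lemma concave_on_slopes:
  fixes F :: "real \<Rightarrow> real"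
  assumes "concave_on I F" "x \<in> I" "w \<in> I" "x \<le> y" "y \<le> z" "z \<le> w"
  shows "(F w - F z) * (y - x) \<le> (F y - F x) * (w - z)"
  using convex_on_slopes[of I "\<lambda>x. - F x" x w y z] assms by (simp add: concave_on_def algebra_simps)

lemma convex_on_setsum:
  fixes f :: "'i \<Rightarrow> 'a::real_vector \<Rightarrow> real"
  assumes "convex S" "\<And>i. i \<in> A \<Longrightarrow> convex_on S (f i)"
  shows "convex_on S (\<lambda>x. \<Sum>i\<in>A. f i x)"
  using assms(2)
proof (induction A rule: infinite_finite_induct)
  case (insert i A)
  then show ?case by (simp add: convex_on_add)
qed (simp_all add: convex_on_const assms(1))

section \<open>The covered share of a disk\<close>

text \<open>The argument \<open>v\<close> is a squared radius, so that an annulus has area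
  \<open>pi\<close> times its length in \<open>v\<close>. For \<open>v < 0\<close> also
  \<open>sqrt v < 0\<close>, so the ball is empty and the share is 0.\<close>

definition disk_share :: "real^2 \<Rightarrow> real \<Rightarrow> real \<Rightarrow> real" where
  "disk_share y R v = measure lborel (ball 0 (sqrt v) \<inter> ball y R) / (pi * R\<^sup>2)"

lemma fmeasurable_ball: "ball a r \<in> fmeasurable lborel"
  for a :: "'a::euclidean_space"
  using emeasure_bounded_finite[OF bounded_ball, of a r] by (intro fmeasurableI) auto

lemma fmeasurable_ball_Int: "ball a r \<inter> ball b s \<in> fmeasurable lborel"
  for a b :: "'a::euclidean_space"
  by (rule fmeasurable_Int_fmeasurable[OF fmeasurable_ball]) simp

lemma norm_less_sqrt_iff: "norm x < sqrt v \<longleftrightarrow> (norm x)\<^sup>2 < v"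
  for x :: "'a::real_normed_vector"
  by (metis norm_ge_zero real_sqrt_abs real_sqrt_less_iff abs_of_nonneg)

lemma disk_share_diff:
  assumes "v1 \<le> v2"
  shows "disk_share y R v2 - disk_share y R v1 =
    measure lborel {x \<in> ball y R. v1 \<le> (norm x)\<^sup>2 \<and> (norm x)\<^sup>2 < v2} / (pi * R\<^sup>2)"
proof -
  have sub: "ball 0 (sqrt v1) \<inter> ball y R \<subseteq> ball 0 (sqrt v2) \<inter> ball y R"
    using assms by (auto simp: norm_less_sqrt_iff)
  have "measure lborel (ball 0 (sqrt v2) \<inter> ball y R) - measure lborel (ball 0 (sqrt v1) \<inter> ball y R)
    = measure lborel ((ball 0 (sqrt v2) \<inter> ball y R) - (ball 0 (sqrt v1) \<inter> ball y R))"
    using sub by (subst measurable_measure_Diff) (auto intro: fmeasurable_ball_Int)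
  also have "(ball 0 (sqrt v2) \<inter> ball y R) - (ball 0 (sqrt v1) \<inter> ball y R) =
    {x \<in> ball y R. v1 \<le> (norm x)\<^sup>2 \<and> (norm x)\<^sup>2 < v2}"
    by (auto simp: norm_less_sqrt_iff)
  finally show ?thesis by (simp only: disk_share_def diff_divide_distrib[symmetric])
qed

lemma disk_share_mono:
  assumes "v1 \<le> v2"
  shows "disk_share y R v1 \<le> disk_share y R v2"
proof -
  have "0 \<le> disk_share y R v2 - disk_share y R v1"
    unfolding disk_share_diff[OF assms] by (intro divide_nonneg_nonneg mult_nonneg_nonneg) auto
  then show ?thesis by simp
qed

lemma fmeasurable_disk_annulus:
  "{x \<in> ball y R. v1 \<le> (norm x)\<^sup>2 \<and> (norm x)\<^sup>2 < v2} \<in> fmeasurable lborel"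
  for y :: "'a::euclidean_space"
proof -
  have "{x \<in> ball y R. v1 \<le> (norm x)\<^sup>2 \<and> (norm x)\<^sup>2 < v2}
    = (ball 0 (sqrt v2) \<inter> ball y R) - ball 0 (sqrt v1)"
    by (auto simp: norm_less_sqrt_iff)
  also have "\<dots> \<in> fmeasurable lborel"
    by (intro fmeasurable_Diff fmeasurable_ball_Int) simp
  finally show ?thesis .
qed

text \<open>The part of the annulus in the disk is bounded by the whole annulus, of area
  \<open>pi * (v2 - v1)\<close>.\<close>

lemma disk_share_lipschitz:
  assumes "0 < R" "0 \<le> v1" "v1 \<le> v2"
  shows "disk_share y R v2 - disk_share y R v1 \<le> (v2 - v1) / R\<^sup>2"
proof -
  have "measure lborel {x \<in> ball y R. v1 \<le> (norm x)\<^sup>2 \<and> (norm x)\<^sup>2 < v2}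
    \<le> measure lborel (ball 0 (sqrt v2) - ball (0::real^2) (sqrt v1))"
  proof (rule measure_mono_fmeasurable)
    show "{x \<in> ball y R. v1 \<le> (norm x)\<^sup>2 \<and> (norm x)\<^sup>2 < v2} \<subseteq> ball 0 (sqrt v2) - ball 0 (sqrt v1)"
      by (auto simp: norm_less_sqrt_iff)
    show "{x \<in> ball y R. v1 \<le> (norm x)\<^sup>2 \<and> (norm x)\<^sup>2 < v2} \<in> sets lborel"
      by (rule fmeasurableD[OF fmeasurable_disk_annulus])
    show "ball 0 (sqrt v2) - ball (0::real^2) (sqrt v1) \<in> fmeasurable lborel"
      by (rule fmeasurable_Diff[OF fmeasurable_ball]) simp
  qed
  also have "\<dots> = measure lborel (ball (0::real^2) (sqrt v2)) - measure lborel (ball (0::real^2) (sqrt v1))"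
    using assms by (subst measurable_measure_Diff) (auto simp: fmeasurable_ball norm_less_sqrt_iff)
  also have "\<dots> = pi * (v2 - v1)"
    using assms by (simp add: circle_area algebra_simps)
  finally have "measure lborel {x \<in> ball y R. v1 \<le> (norm x)\<^sup>2 \<and> (norm x)\<^sup>2 < v2} / (pi * R\<^sup>2)
    \<le> pi * (v2 - v1) / (pi * R\<^sup>2)"
    by (intro divide_right_mono) auto
  then show ?thesis using disk_share_diff[OF assms(3), of y R] by simp
qed

lemma continuous_on_disk_share:
  assumes "0 < R"
  shows "continuous_on {0..} (disk_share y R)"
proof -
  have "(1 / R\<^sup>2)-lipschitz_on {0..} (disk_share y R)"
  proof (rule lipschitz_onI)
    fix v w :: real assume vw: "v \<in> {0..}" "w \<in> {0..}"
    show "dist (disk_share y R v) (disk_share y R w) \<le> 1 / R\<^sup>2 * dist v w"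
    proof (cases "v \<le> w")
      case True
      then show ?thesis using disk_share_lipschitz[of R v w y] disk_share_mono[of v w y R] assms vw
        by (simp add: dist_real_def)
    next
      case False
      then show ?thesis using disk_share_lipschitz[of R w v y] disk_share_mono[of w v y R] assms vw
        by (simp add: dist_real_def)
    qed
  qed simp
  then show ?thesis by (rule lipschitz_on_continuous_on)
qed

section \<open>Dilations of the plane and convexity of the share\<close>

lemma scaleR_image_borel:
  fixes S :: "'a::euclidean_space set"
  assumes "S \<in> sets borel" "c \<noteq> 0"
  shows "(*\<^sub>R) c ` S \<in> sets borel"
proof -
  have "x \<in> (*\<^sub>R) c ` S \<longleftrightarrow> (1 / c) *\<^sub>R x \<in> S" for x
  proof
    assume "(1 / c) *\<^sub>R x \<in> S"
    then have "c *\<^sub>R ((1 / c) *\<^sub>R x) \<in> (*\<^sub>R) c ` S" by (rule imageI)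
    then show "x \<in> (*\<^sub>R) c ` S" using assms(2) by (simp only: scaleR_scaleR) simp
  next
    assume "x \<in> (*\<^sub>R) c ` S"
    then obtain z where "z \<in> S" "x = c *\<^sub>R z" by blast
    then show "(1 / c) *\<^sub>R x \<in> S" using assms(2) by simp
  qed
  then have "(*\<^sub>R) c ` S = (*\<^sub>R) (1 / c) -` S" by (intro set_eqI) (simp only: vimage_eq)
  also have "\<dots> \<in> sets borel"
    using measurable_sets_borel[OF borel_measurable_continuous_onI[OF
      continuous_on_scaleR[OF continuous_on_const continuous_on_id]] assms(1)] by simp
  finally show ?thesis .
qed

lemma measure_lborel_scaleR_image:
  fixes S :: "'a::euclidean_space set"
  assumes "S \<in> sets borel" "c \<noteq> 0"
  shows "measure lborel ((*\<^sub>R) c ` S) = \<bar>c\<bar> ^ DIM('a) * measure lborel S"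
proof -
  have "measure lborel ((*\<^sub>R) c ` S) = measure lebesgue ((*\<^sub>R) c ` S)"
    by (rule measure_completion[symmetric]) (simp add: scaleR_image_borel assms)
  also have "\<dots> = \<bar>c\<bar> ^ DIM('a) * measure lebesgue S"
    using measure_lebesgue_affine[of c 0 S] by simp
  also have "measure lebesgue S = measure lborel S"
    by (rule measure_completion) (simp add: assms)
  finally show ?thesis .
qed

text \<open>With \<open>M = |y|^2 - R^2\<close>, membership of \<open>c x\<close> means
  \<open>M + c^2 |x|^2 < 2 c (y . x)\<close>, while membership of \<open>x\<close> gives
  \<open>c M + c |x|^2 < 2 c (y . x)\<close>. The left sides differ by exactly the product assumed
  to be nonpositive.\<close>

lemma scale_mem_ball:
  fixes x y :: "'a::real_inner"
  assumes "x \<in> ball y R" "0 < c" "(c - 1) * (c * (norm x)\<^sup>2 - ((norm y)\<^sup>2 - R\<^sup>2)) \<le> 0"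
  shows "c *\<^sub>R x \<in> ball y R"
proof -
  have sq: "(dist y z)\<^sup>2 = (norm y)\<^sup>2 - 2 * (y \<bullet> z) + (norm z)\<^sup>2" for z
    by (simp add: dist_norm power2_norm_eq_inner inner_diff inner_commute algebra_simps)
  have R: "0 < R" using assms(1) by (auto intro: le_less_trans[OF zero_le_dist])
  have "(dist y x)\<^sup>2 < R\<^sup>2" using assms(1) by (simp add: power_strict_mono)
  then have "c * ((norm y)\<^sup>2 - R\<^sup>2 + (norm x)\<^sup>2) < c * (2 * (y \<bullet> x))"
    using assms(2) by (simp add: sq)
  then have "(norm y)\<^sup>2 - R\<^sup>2 + c\<^sup>2 * (norm x)\<^sup>2 < 2 * (y \<bullet> (c *\<^sub>R x))"
    using assms(3) by (simp add: algebra_simps power2_eq_square)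
  then have "(dist y (c *\<^sub>R x))\<^sup>2 < R\<^sup>2" by (simp add: sq power_mult_distrib)
  then show ?thesis using R by (simp add: power_less_imp_less_base)
qed

text \<open>The dilation by \<open>c\<close> multiplies areas by \<open>c^2\<close> and maps the
  annulus over \<open>[v1, v2)\<close> to the one over \<open>[c^2 v1, c^2 v2)\<close>;
  \<open>cond\<close> keeps the image of the covered part inside the disk.\<close>

lemma disk_share_scaling:
  assumes "v1 \<le> v2" "0 < c"
    and cond: "\<And>v. v1 \<le> v \<Longrightarrow> v \<le> v2 \<Longrightarrow> (c - 1) * (c * v - ((norm y)\<^sup>2 - R\<^sup>2)) \<le> 0"
  shows "c\<^sup>2 * (disk_share y R v2 - disk_share y R v1) \<le> disk_share y R (c\<^sup>2 * v2) - disk_share y R (c\<^sup>2 * v1)"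
proof -
  let ?A = "\<lambda>a b. {x \<in> ball y R. a \<le> (norm x)\<^sup>2 \<and> (norm x)\<^sup>2 < b}"
  have "c\<^sup>2 * measure lborel (?A v1 v2) = measure lborel ((*\<^sub>R) c ` ?A v1 v2)"
    using assms(2) fmeasurable_disk_annulus[of y R v1 v2]
    by (subst measure_lborel_scaleR_image) (auto dest: fmeasurableD)
  also have "\<dots> \<le> measure lborel (?A (c\<^sup>2 * v1) (c\<^sup>2 * v2))"
  proof (rule measure_mono_fmeasurable)
    show "(*\<^sub>R) c ` ?A v1 v2 \<subseteq> ?A (c\<^sup>2 * v1) (c\<^sup>2 * v2)"
    proof safe
      fix x assume x: "x \<in> ball y R" "v1 \<le> (norm x)\<^sup>2" "(norm x)\<^sup>2 < v2"
      show "c *\<^sub>R x \<in> ball y R"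
        using x assms(2) cond[of "(norm x)\<^sup>2"] by (intro scale_mem_ball) auto
      show "c\<^sup>2 * v1 \<le> (norm (c *\<^sub>R x))\<^sup>2" "(norm (c *\<^sub>R x))\<^sup>2 < c\<^sup>2 * v2"
        using x assms(2) by (auto simp: power_mult_distrib)
    qed
    show "(*\<^sub>R) c ` ?A v1 v2 \<in> sets lborel"
      using fmeasurableD[OF fmeasurable_disk_annulus[of y R v1 v2]] assms(2)
      by (simp only: sets_lborel scaleR_image_borel)
  qed (rule fmeasurable_disk_annulus)
  finally have "c\<^sup>2 * measure lborel (?A v1 v2) / (pi * R\<^sup>2) \<le> measure lborel (?A (c\<^sup>2 * v1) (c\<^sup>2 * v2)) / (pi * R\<^sup>2)"
    by (rule divide_right_mono) simp
  then show ?thesis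
    using assms by (simp add: disk_share_diff)
qed

text \<open>Before the inflection, stretching by \<open>sqrt \<mu>\<close> carries the part of the
  disk over \<open>[v / \<mu>, v]\<close> into its part over \<open>[v, v * \<mu>]\<close>.\<close>

lemma convex_on_disk_share:
  assumes "0 < R"
  shows "convex_on {0<..(norm y)\<^sup>2 - R\<^sup>2} (disk_share y R)"
proof (rule convex_on_of_scaling)
  let ?M = "(norm y)\<^sup>2 - R\<^sup>2"
  show "continuous_on {0<..?M} (disk_share y R)"
    by (rule continuous_on_subset[OF continuous_on_disk_share[OF assms]]) auto
  fix v \<mu> :: real
  assume mu: "1 < \<mu>" and v: "v / \<mu> \<in> {0<..?M}" "v * \<mu> \<in> {0<..?M}"
  have v0: "0 < v" using v mu by (simp add: zero_less_divide_iff)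
  have "(sqrt \<mu>)\<^sup>2 * (disk_share y R v - disk_share y R (v / \<mu>))
    \<le> disk_share y R ((sqrt \<mu>)\<^sup>2 * v) - disk_share y R ((sqrt \<mu>)\<^sup>2 * (v / \<mu>))"
  proof (rule disk_share_scaling)
    fix w assume w: "v / \<mu> \<le> w" "w \<le> v"
    have "0 \<le> w" using w v by (metis greaterThanAtMost_iff less_le_trans less_imp_le)
    have "sqrt \<mu> \<le> \<mu>" using mu mult_left_mono[of 1 "sqrt \<mu>" "sqrt \<mu>"] by simp
    then have "sqrt \<mu> * w \<le> \<mu> * v" using w \<open>0 \<le> w\<close> mu by (intro mult_mono) auto
    then show "(sqrt \<mu> - 1) * (sqrt \<mu> * w - ?M) \<le> 0"
      using mu v by (intro mult_nonneg_nonpos) (auto simp: mult.commute)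
  qed (use mu v0 in \<open>auto simp: field_simps\<close>)
  then show "\<mu> * (disk_share y R v - disk_share y R (v / \<mu>)) \<le> disk_share y R (v * \<mu>) - disk_share y R v"
    using mu by (simp add: mult.commute)
qed auto

text \<open>Beyond the inflection, shrinking by \<open>1 / sqrt \<mu>\<close> carries the part over
  \<open>[v, v * \<mu>]\<close> into the part over \<open>[v / \<mu>, v]\<close>, which is the
  scaling inequality for the negated share.\<close>

lemma concave_on_disk_share:
  assumes "0 < R"
  shows "concave_on {v. 0 < v \<and> (norm y)\<^sup>2 - R\<^sup>2 \<le> v} (disk_share y R)"
  unfolding concave_on_def
proof (rule convex_on_of_scaling)
  let ?M = "(norm y)\<^sup>2 - R\<^sup>2"
  have eq: "{v. 0 < v \<and> ?M \<le> v} = {0<..} \<inter> {?M..}" by auto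
  show "convex {v. 0 < v \<and> ?M \<le> v}" unfolding eq by (intro convex_Int convex_real_interval)
  show "continuous_on {v. 0 < v \<and> ?M \<le> v} (\<lambda>v. - disk_share y R v)"
    by (intro continuous_intros continuous_on_subset[OF continuous_on_disk_share[OF assms]]) auto
  fix v \<mu> :: real
  assume mu: "1 < \<mu>" and v: "v / \<mu> \<in> {v. 0 < v \<and> ?M \<le> v}" "v * \<mu> \<in> {v. 0 < v \<and> ?M \<le> v}"
  define c where "c = 1 / sqrt \<mu>"
  have v0: "0 < v" using v mu by (simp add: zero_less_divide_iff)
  have c: "0 < c" "c < 1" "c\<^sup>2 = 1 / \<mu>" using mu by (auto simp: c_def power_divide)
  have "c\<^sup>2 * (disk_share y R (v * \<mu>) - disk_share y R v)
    \<le> disk_share y R (c\<^sup>2 * (v * \<mu>)) - disk_share y R (c\<^sup>2 * v)"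
  proof (rule disk_share_scaling)
    fix w assume w: "v \<le> w" "w \<le> v * \<mu>"
    have "?M \<le> c\<^sup>2 * v" using v c by simp
    also have "c\<^sup>2 \<le> c" using c(1,2) by (simp add: power2_eq_square mult_left_le)
    then have "c\<^sup>2 * v \<le> c * w" using w c(1) v0 by (intro mult_mono) auto
    finally show "(c - 1) * (c * w - ?M) \<le> 0"
      using c by (intro mult_nonpos_nonneg) auto
  qed (use mu v0 c in \<open>auto simp: field_simps\<close>)
  then show "\<mu> * (- disk_share y R v - - disk_share y R (v / \<mu>)) \<le> - disk_share y R (v * \<mu>) - - disk_share y R v"
    using mu c by (simp add: field_simps)
qed auto

section \<open>Quantitative bounds for the share and its slope\<close>

lemma disk_share_eq_0:
  assumes "R \<le> norm y" "v \<le> (norm y - R)\<^sup>2"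
  shows "disk_share y R v = 0"
proof -
  have "v \<le> (norm x)\<^sup>2" if "x \<in> ball y R" for x
  proof -
    have "norm y - R \<le> norm x"
      using that norm_triangle_ineq2[of y x] unfolding mem_ball dist_norm by linarith
    then have "(norm y - R)\<^sup>2 \<le> (norm x)\<^sup>2" using assms(1) by (intro power_mono) auto
    then show ?thesis using assms(2) by linarith
  qed
  then have "ball 0 (sqrt v) \<inter> ball y R = {}"
    by (force simp: norm_less_sqrt_iff)
  then show ?thesis by (simp add: disk_share_def)
qed

lemma disk_share_eq_1:
  assumes "0 < R" "(norm y + R)\<^sup>2 \<le> v"
  shows "disk_share y R v = 1"
proof -
  have "(norm x)\<^sup>2 < v" if "x \<in> ball y R" for x
  proof -
    have "norm x < norm y + R"
      using that norm_triangle_ineq2[of x y] unfolding mem_ball dist_norm norm_minus_commute[of y] by linarith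
    then have "(norm x)\<^sup>2 < (norm y + R)\<^sup>2" by (intro power_strict_mono) auto
    then show ?thesis using assms(2) by linarith
  qed
  then have "ball 0 (sqrt v) \<inter> ball y R = ball y R"
    by (auto simp: norm_less_sqrt_iff)
  then show ?thesis using assms(1) by (simp add: disk_share_def circle_area)
qed

lemma disk_share_nonneg: "0 \<le> disk_share y R v"
  by (simp add: disk_share_def)

lemma disk_share_le_1:
  assumes "0 < R"
  shows "disk_share y R v \<le> 1"
  using disk_share_mono[of v "max v ((norm y + R)\<^sup>2)" y R] disk_share_eq_1[OF assms, of y "max v ((norm y + R)\<^sup>2)"] by simp

text \<open>A share that hardly changes around \<open>r\<close> is almost 0 or almost 1. Before the
  inflection earlier slopes are smaller, so the share accumulated since it was 0 is controlled by
  the increment \<open>g\<close>; beyond it, concavity controls what is missing to 1.\<close>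

lemma disk_share_near_01:
  assumes R: "0 < R" and h: "0 < h" "h \<le> R" and r: "7/4 * R \<le> r"
  shows "\<exists>e\<in>{0,1}. \<bar>disk_share y R (r\<^sup>2) - e\<bar> \<le> 2 * R / h * (disk_share y R ((r + h)\<^sup>2) - disk_share y R ((r - h)\<^sup>2))"
proof -
  let ?f = "disk_share y R"
  define d where "d = norm y"
  define M where "M = d\<^sup>2 - R\<^sup>2"
  define g where "g = ?f ((r + h)\<^sup>2) - ?f ((r - h)\<^sup>2)"
  have rm: "(r - h)\<^sup>2 \<le> r\<^sup>2" "r\<^sup>2 \<le> (r + h)\<^sup>2" using R h r by (auto intro!: power_mono)
  have d0: "0 \<le> d" by (simp add: d_def)
  have mono: "?f ((r - h)\<^sup>2) \<le> ?f (r\<^sup>2)" "?f (r\<^sup>2) \<le> ?f ((r + h)\<^sup>2)"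
    using rm by (auto intro: disk_share_mono)
  then have g0: "0 \<le> g" by (simp add: g_def)
  have g2: "h * g \<le> 2 * R * g" using h R g0 by (intro mult_right_mono) auto
  have "\<exists>e\<in>{0,1}. h * \<bar>?f (r\<^sup>2) - e\<bar> \<le> 2 * R * g"
  proof (cases "r\<^sup>2 \<le> M")
    case True
    have "r\<^sup>2 \<le> d\<^sup>2" using True zero_le_power2[of R] unfolding M_def by linarith
    then have rd: "r \<le> d" using d0 by (rule power2_le_imp_le)
    have "h * ?f (r\<^sup>2) \<le> 2 * R * g"
    proof (cases "(r - h)\<^sup>2 \<le> (d - R)\<^sup>2")
      case True
      \<comment> \<open>The window starts where the disk is still untouched, so the increment
        \<open>g\<close> contains the whole share.\<close>
      then have "?f ((r - h)\<^sup>2) = 0" using rd r R by (intro disk_share_eq_0) (auto simp: d_def)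
      then have "?f (r\<^sup>2) \<le> g" using mono by (simp add: g_def)
      then have "h * ?f (r\<^sup>2) \<le> h * g" using h by simp
      then show ?thesis using g2 by linarith
    next
      case False
      have pos: "0 < (d - R)\<^sup>2" using rd r R by simp
      have z: "?f ((d - R)\<^sup>2) = 0" using rd r R by (intro disk_share_eq_0) (auto simp: d_def)
      have "(?f ((r - h)\<^sup>2) - ?f ((d - R)\<^sup>2)) * (r\<^sup>2 - (r - h)\<^sup>2) \<le> (?f (r\<^sup>2) - ?f ((r - h)\<^sup>2)) * ((r - h)\<^sup>2 - (d - R)\<^sup>2)"
        using pos False True rm R r
        by (intro convex_on_slopes[OF convex_on_disk_share[OF R, of y]]) (auto simp: M_def d_def)
      then have "?f (r\<^sup>2) * (r\<^sup>2 - (r - h)\<^sup>2) \<le> (?f (r\<^sup>2) - ?f ((r - h)\<^sup>2)) * (r\<^sup>2 - (d - R)\<^sup>2)"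
        using z by (simp add: algebra_simps)
      also have "\<dots> \<le> g * (r\<^sup>2 - (d - R)\<^sup>2)"
        using mono False rm by (intro mult_right_mono) (auto simp: g_def)
      finally have 1: "?f (r\<^sup>2) * (r\<^sup>2 - (r - h)\<^sup>2) \<le> g * (r\<^sup>2 - (d - R)\<^sup>2)" .
      have "(r - R)\<^sup>2 \<le> (d - R)\<^sup>2" using rd r R by (intro power_mono) auto
      then have 2: "r\<^sup>2 - (d - R)\<^sup>2 \<le> R * (2 * r - R)" by (simp add: power2_eq_square algebra_simps)
      have 3: "r\<^sup>2 - (r - h)\<^sup>2 = h * (2 * r - h)" by (simp add: power2_eq_square algebra_simps)
      have "h * ?f (r\<^sup>2) * (2 * r - h) \<le> g * (R * (2 * r - R))"
        using 1 3 mult_left_mono[OF 2 g0] by (simp add: mult_ac)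
      also have "\<dots> \<le> g * (R * (2 * r - h))" using g0 R h by (intro mult_left_mono) auto
      also have "\<dots> = (g * R) * (2 * r - h)" by simp
      finally have "h * ?f (r\<^sup>2) \<le> g * R" using r R h by (simp add: mult_le_cancel_right)
      also have "\<dots> \<le> 2 * R * g" using g0 R by simp
      finally show ?thesis .
    qed
    then show ?thesis using disk_share_nonneg[of y R "r\<^sup>2"] by (intro bexI[of _ 0]) auto
  next
    case False
    then have dr: "d\<^sup>2 \<le> r\<^sup>2 + R\<^sup>2" by (simp add: M_def)
    have "h * (1 - ?f (r\<^sup>2)) \<le> 2 * R * g"
    proof (cases "(d + R)\<^sup>2 \<le> (r + h)\<^sup>2")
      case True
      then have "?f ((r + h)\<^sup>2) = 1" using R by (intro disk_share_eq_1) (auto simp: d_def)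
      then have "1 - ?f (r\<^sup>2) \<le> g" using mono by (simp add: g_def)
      then have "h * (1 - ?f (r\<^sup>2)) \<le> h * g" using h by simp
      then show ?thesis using g2 by linarith
    next
      case F: False
      have z: "?f ((d + R)\<^sup>2) = 1" using R by (intro disk_share_eq_1) (auto simp: d_def)
      have r0: "0 < r" using r R by linarith
      have "(?f ((d + R)\<^sup>2) - ?f ((r + h)\<^sup>2)) * ((r + h)\<^sup>2 - r\<^sup>2) \<le> (?f ((r + h)\<^sup>2) - ?f (r\<^sup>2)) * ((d + R)\<^sup>2 - (r + h)\<^sup>2)"
        using F False rm r0 R d0
        by (intro concave_on_slopes[OF concave_on_disk_share[OF R, of y]]) (auto simp: M_def d_def)
      then have "(1 - ?f (r\<^sup>2)) * ((r + h)\<^sup>2 - r\<^sup>2) \<le> (?f ((r + h)\<^sup>2) - ?f (r\<^sup>2)) * ((d + R)\<^sup>2 - r\<^sup>2)"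
        using z by (simp add: algebra_simps)
      also have "\<dots> \<le> g * ((d + R)\<^sup>2 - r\<^sup>2)"
        using mono F rm by (intro mult_right_mono) (auto simp: g_def)
      finally have 1: "(1 - ?f (r\<^sup>2)) * ((r + h)\<^sup>2 - r\<^sup>2) \<le> g * ((d + R)\<^sup>2 - r\<^sup>2)" .
      \<comment> \<open>\<open>r >= 4/3 R\<close> is exactly what
        \<open>r^2 + R^2 <= (2 r - R)^2\<close> requires.\<close>
      have "r * (4/3 * R) \<le> r * r" using r r0 R by (intro mult_left_mono) auto
      moreover have "(2 * r - R)\<^sup>2 = 4 * (r * r) - 4 * (r * R) + R\<^sup>2" by algebra
      ultimately have "d\<^sup>2 \<le> (2 * r - R)\<^sup>2" using dr unfolding power2_eq_square[of r] by linarith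
      then have "d \<le> 2 * r - R" by (rule power2_le_imp_le) (use r R in linarith)
      then have "2 * R * (d + R) \<le> 2 * R * (2 * r)" using R by (intro mult_left_mono) auto
      moreover have "(d + R)\<^sup>2 = d\<^sup>2 - R\<^sup>2 + 2 * R * (d + R)" by algebra
      ultimately have 2: "(d + R)\<^sup>2 - r\<^sup>2 \<le> 2 * R * (2 * r)" using dr by linarith
      have 3: "(r + h)\<^sup>2 - r\<^sup>2 = h * (2 * r + h)" by (simp add: power2_eq_square algebra_simps)
      have "h * (1 - ?f (r\<^sup>2)) * (2 * r + h) = (1 - ?f (r\<^sup>2)) * ((r + h)\<^sup>2 - r\<^sup>2)" unfolding 3 by simp
      also have "\<dots> \<le> g * (2 * R * (2 * r))"
        using 1 mult_left_mono[OF 2 g0] by linarith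
      also have "\<dots> \<le> g * (2 * R * (2 * r + h))" using g0 R h by (intro mult_left_mono) auto
      also have "\<dots> = (2 * R * g) * (2 * r + h)" by simp
      finally show ?thesis by (rule mult_right_le_imp_le) (use r0 h in simp)
    qed
    then show ?thesis using disk_share_le_1[OF R, of y "r\<^sup>2"] by (intro bexI[of _ 1]) auto
  qed
  then show ?thesis using h by (simp add: g_def pos_le_divide_eq mult.commute)
qed

text \<open>The ball of radius \<open>e\<close> about the point at distance \<open>s\<close> from
  the origin on the ray through \<open>y\<close> lies in the disk and between the radii
  \<open>r1\<close> and \<open>r2\<close>; its area gives the bound.\<close>

lemma disk_share_diff_ge:
  assumes R: "0 < R" and y: "y \<noteq> 0" and e: "0 \<le> e"
    and r1: "0 \<le> r1" "r1 \<le> s - e" and r2: "s + e \<le> r2" and s: "\<bar>s - norm y\<bar> \<le> R - e"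
  shows "e\<^sup>2 / R\<^sup>2 \<le> disk_share y R (r2\<^sup>2) - disk_share y R (r1\<^sup>2)"
proof -
  define z where "z = (s / norm y) *\<^sub>R y"
  have nz: "norm z = s" using r1 e y by (simp add: z_def)
  have "y - z = ((norm y - s) / norm y) *\<^sub>R y" using y by (simp add: z_def diff_divide_distrib scaleR_left_diff_distrib)
  then have dz: "dist y z = \<bar>s - norm y\<bar>" using y by (simp add: dist_norm)
  let ?A = "{x \<in> ball y R. r1\<^sup>2 \<le> (norm x)\<^sup>2 \<and> (norm x)\<^sup>2 < r2\<^sup>2}"
  have "ball z e \<subseteq> ?A"
  proof
    fix x assume x: "x \<in> ball z e"
    have "dist y x < R" using x s dz dist_triangle[of y x z] by simp
    moreover have "\<bar>norm x - s\<bar> < e" using x norm_triangle_ineq3[of x z]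
      by (simp add: nz dist_norm norm_minus_commute)
    then have "r1 \<le> norm x" "norm x < r2" using r1 r2 by linarith+
    ultimately show "x \<in> ?A" using r1 by (auto intro!: power_mono power_strict_mono)
  qed
  then have "measure lborel (ball z e) \<le> measure lborel ?A"
    by (intro measure_mono_fmeasurable fmeasurable_disk_annulus) auto
  then have "e\<^sup>2 * pi / (pi * R\<^sup>2) \<le> measure lborel ?A / (pi * R\<^sup>2)"
    using e by (intro divide_right_mono) (simp_all add: circle_area)
  moreover have "r1\<^sup>2 \<le> r2\<^sup>2" using r1 r2 e by (intro power_mono) auto
  ultimately show ?thesis by (simp only: disk_share_diff) (simp add: mult.commute)
qed

text \<open>The inflection lies in the window, so the share has reached \<open>1/16\<close> at
  radius \<open>a\<close> and still lacks \<open>1/16\<close> at the end. Convexity up to the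
  inflection and concavity after it bound the slope below by \<open>1/16\<close> over a length of at
  most \<open>6 a R\<close>, whence \<open>96 = 16 * 6\<close>.\<close>

lemma disk_share_slope_ge:
  assumes R: "0 < R" and a: "7/4 * R \<le> a"
    and M: "a\<^sup>2 \<le> (norm y)\<^sup>2 - R\<^sup>2" "(norm y)\<^sup>2 - R\<^sup>2 \<le> (a + R/4)\<^sup>2"
    and vw: "a\<^sup>2 \<le> v" "v \<le> w" "w \<le> (a + R/4)\<^sup>2"
  shows "(w - v) \<le> 96 * a * R * (disk_share y R w - disk_share y R v)"
proof -
  let ?f = "disk_share y R"
  define d where "d = norm y"
  define b where "b = a + R/4"
  have a0: "0 < a" using a R by linarith
  have "a\<^sup>2 \<le> d\<^sup>2" using M(1) zero_le_power2[of R] unfolding d_def by linarith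
  then have ad: "a \<le> d" by (rule power2_le_imp_le) (simp add: d_def)
  \<comment> \<open>Going from \<open>d^2 <= (a + R/4)^2 + R^2\<close> to \<open>(a + R/2)^2\<close>
    takes \<open>a >= 13/8 R\<close>, which \<open>7/4\<close> covers.\<close>
  have "7/4 * (R * R) \<le> a * R" using mult_right_mono[OF a, of R] R by simp
  moreover have "(a + R/4)\<^sup>2 = a * a + a * R / 2 + R * R / 16" "(a + R/2)\<^sup>2 = a * a + a * R + R * R / 4"
    by (simp_all add: power2_eq_square algebra_simps)
  moreover have "0 \<le> R * R" by simp
  ultimately have "d\<^sup>2 \<le> (a + R/2)\<^sup>2" using M(2) unfolding d_def power2_eq_square[of R] by linarith
  then have da: "d \<le> a + R/2" by (rule power2_le_imp_le) (use a0 R in simp)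
  have y0: "y \<noteq> 0" using ad a0 by (auto simp: d_def)
  \<comment> \<open>A ball of radius \<open>R/4\<close> at the inner end of the disk fits within
    radius \<open>a\<close>; for \<open>hi\<close>, one at the outer end fits beyond
    \<open>b\<close>.\<close>
  have lo: "1/16 \<le> ?f (a\<^sup>2)"
  proof -
    have "(R/4)\<^sup>2 / R\<^sup>2 \<le> ?f (a\<^sup>2) - ?f ((d - R)\<^sup>2)"
      by (rule disk_share_diff_ge[where s = "d - R + R/4"]) (use R y0 ad a da in \<open>auto simp: d_def\<close>)
    moreover have "?f ((d - R)\<^sup>2) = 0" using ad a R by (intro disk_share_eq_0) (auto simp: d_def)
    ultimately show ?thesis using R by (simp add: power_divide)
  qed
  have hi: "1/16 \<le> 1 - ?f (b\<^sup>2)"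
  proof -
    have "(R/4)\<^sup>2 / R\<^sup>2 \<le> ?f ((d + R)\<^sup>2) - ?f (b\<^sup>2)"
      by (rule disk_share_diff_ge[where s = "d + R - R/4"]) (use R y0 ad a da in \<open>auto simp: d_def b_def\<close>)
    moreover have "?f ((d + R)\<^sup>2) = 1" using R by (intro disk_share_eq_1) (auto simp: d_def)
    ultimately show ?thesis using R by (simp add: power_divide)
  qed
  have left: "w - v \<le> 96 * a * R * (?f w - ?f v)" if "a\<^sup>2 \<le> v" "v \<le> w" "w \<le> d\<^sup>2 - R\<^sup>2" for v w
  proof -
    have z: "?f ((d - R)\<^sup>2) = 0" using ad a R by (intro disk_share_eq_0) (auto simp: d_def)
    have pos: "0 < (d - R)\<^sup>2" "(d - R)\<^sup>2 \<le> a\<^sup>2" using ad a R da by (auto intro!: power_mono)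
    have w0: "0 < w" using that pos by linarith
    have "(?f (a\<^sup>2) - ?f ((d - R)\<^sup>2)) * (w - v) \<le> (?f w - ?f v) * (a\<^sup>2 - (d - R)\<^sup>2)"
      using pos that by (intro convex_on_slopes[OF convex_on_disk_share[OF R, of y]]) (auto simp: d_def w0)
    moreover have "1/16 * (w - v) \<le> ?f (a\<^sup>2) * (w - v)" using lo that by (intro mult_right_mono) auto
    ultimately have "1/16 * (w - v) \<le> (?f w - ?f v) * (a\<^sup>2 - (d - R)\<^sup>2)" using z by simp
    also have "\<dots> \<le> (?f w - ?f v) * (6 * a * R)"
    proof (rule mult_left_mono)
      have "(a - R)\<^sup>2 \<le> (d - R)\<^sup>2" using ad a R by (intro power_mono) auto
      moreover have "0 \<le> a * R" "0 \<le> R * R" using a0 R by auto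
      moreover have "(a - R)\<^sup>2 = a\<^sup>2 - 2 * (a * R) + R * R" by (simp add: power2_eq_square algebra_simps)
      ultimately show "a\<^sup>2 - (d - R)\<^sup>2 \<le> 6 * a * R" by linarith
    qed (simp add: disk_share_mono that)
    finally show ?thesis by (simp add: mult_ac)
  qed
  have right: "w - v \<le> 96 * a * R * (?f w - ?f v)" if "a\<^sup>2 \<le> v" "d\<^sup>2 - R\<^sup>2 \<le> v" "v \<le> w" "w \<le> b\<^sup>2" for v w
  proof -
    have z: "?f ((d + R)\<^sup>2) = 1" using R by (intro disk_share_eq_1) (auto simp: d_def)
    have pos: "0 < v" using that a0 by (metis zero_less_power less_le_trans)
    have le: "b\<^sup>2 \<le> (d + R)\<^sup>2" using ad a0 R by (intro power_mono) (auto simp: b_def)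
    have "(?f ((d + R)\<^sup>2) - ?f (b\<^sup>2)) * (w - v) \<le> (?f w - ?f v) * ((d + R)\<^sup>2 - b\<^sup>2)"
      using pos that le by (intro concave_on_slopes[OF concave_on_disk_share[OF R, of y]]) (auto simp: d_def)
    moreover have "1/16 * (w - v) \<le> (1 - ?f (b\<^sup>2)) * (w - v)" using hi that by (intro mult_right_mono) auto
    ultimately have "1/16 * (w - v) \<le> (?f w - ?f v) * ((d + R)\<^sup>2 - b\<^sup>2)" using z by simp
    also have "\<dots> \<le> (?f w - ?f v) * (6 * a * R)"
    proof (rule mult_left_mono)
      have "(d + R)\<^sup>2 - b\<^sup>2 \<le> 2 * (R * R) + 2 * (R * d)" using M(2) by (simp add: power2_eq_square algebra_simps d_def b_def)
      moreover have "R * d \<le> R * (a + R/2)" using da R by (intro mult_left_mono) auto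
      moreover have "R * R \<le> R * a" using a R by (intro mult_left_mono) auto
      moreover have "R * (a + R/2) = R * a + R * R / 2" "6 * a * R = 6 * (R * a)" by (simp_all add: algebra_simps)
      moreover have "0 \<le> R * R" by simp
      ultimately show "(d + R)\<^sup>2 - b\<^sup>2 \<le> 6 * a * R" by linarith
    qed (simp add: disk_share_mono that)
    finally show ?thesis by (simp add: mult_ac)
  qed
  consider "w \<le> d\<^sup>2 - R\<^sup>2" | "d\<^sup>2 - R\<^sup>2 \<le> v" | "v \<le> d\<^sup>2 - R\<^sup>2" "d\<^sup>2 - R\<^sup>2 \<le> w" by linarith
  then show ?thesis
  proof cases
    case 3
    then show ?thesis using left[of v "d\<^sup>2 - R\<^sup>2"] right[of "d\<^sup>2 - R\<^sup>2" w] vw M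
      by (simp add: d_def b_def right_diff_distrib)
  qed (use left right vw in \<open>simp_all add: b_def\<close>)
qed

text \<open>The disk lies in one of twice the radius whose inflection is beyond the interval in question;
  convexity of the share of the latter gives the upper bound.\<close>
lemma disk_share_slope_le:
  assumes R: "0 < R" and a: "7/4 * R \<le> a"
    and M: "a\<^sup>2 \<le> (norm y)\<^sup>2 - R\<^sup>2"
    and vw: "a\<^sup>2 \<le> v" "v \<le> w" "w \<le> (a + R/4)\<^sup>2"
  shows "2 * a * R * (disk_share y R w - disk_share y R v) \<le> 25 * (w - v)"
proof -
  define d where "d = norm y"
  define b where "b = a + R/4"
  \<comment> \<open>The centre is moved outward by \<open>R\<close> along its ray, so the disk of
    radius \<open>2 R\<close> about \<open>y'\<close> contains the original one.\<close>
  define y' where "y' = (1 + R / d) *\<^sub>R y"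
  let ?g = "disk_share y' (2 * R)"
  have a0: "0 < a" using a R by linarith
  have "a\<^sup>2 \<le> d\<^sup>2" using M zero_le_power2[of R] unfolding d_def by linarith
  then have ad: "a \<le> d" by (rule power2_le_imp_le) (simp add: d_def)
  have d0: "0 < d" using ad a0 by simp
  have "norm y' = \<bar>1 + R / d\<bar> * d" by (simp add: y'_def d_def)
  also have "\<dots> = d + R" using d0 R by (simp add: field_simps)
  finally have ny': "norm y' = d + R" .
  have "y' - y = (R / d) *\<^sub>R y" by (simp add: y'_def scaleR_left_distrib)
  then have dy: "dist y' y = R" using d0 R by (simp add: dist_norm d_def)
  let ?A = "\<lambda>y R. {x \<in> ball y R. v \<le> (norm x)\<^sup>2 \<and> (norm x)\<^sup>2 < w}"
  have "?A y R \<subseteq> ?A y' (2 * R)"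
  proof
    fix x assume "x \<in> ?A y R"
    then show "x \<in> ?A y' (2 * R)" using dy dist_triangle[of y' x y] by simp
  qed
  then have "measure lborel (?A y R) \<le> measure lborel (?A y' (2 * R))"
    by (intro measure_mono_fmeasurable fmeasurable_disk_annulus fmeasurableD[OF fmeasurable_disk_annulus])
  then have "measure lborel (?A y R) / (pi * R\<^sup>2) \<le> measure lborel (?A y' (2 * R)) / (pi * R\<^sup>2)"
    by (intro divide_right_mono) auto
  also have "\<dots> = 4 * (measure lborel (?A y' (2 * R)) / (pi * (2 * R)\<^sup>2))" by (simp add: power2_eq_square)
  finally have 1: "disk_share y R w - disk_share y R v \<le> 4 * (?g w - ?g v)"
    by (simp only: disk_share_diff[OF vw(2)])
  define M' where "M' = (d + R)\<^sup>2 - (2 * R)\<^sup>2"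
  \<comment> \<open>\<open>M'\<close> is the inflection of the large disk. From
    \<open>d^2 >= a^2 + R^2\<close> and \<open>R <= 4/7 a\<close> the gap is at least
    \<open>9/28 a R\<close>, slightly more than \<open>8/25 a R\<close>. The final 25 is
    \<open>2 * 4\<close> divided by \<open>8/25\<close>, where 4 is the ratio of the disk
    areas.\<close>
  have M'b: "8/25 * (a * R) \<le> M' - b\<^sup>2"
  proof -
    have "a * R \<le> d * R" using ad R by simp
    moreover have "7/4 * (R * R) \<le> a * R" using mult_right_mono[OF a, of R] R by simp
    moreover have "0 \<le> R * R" by simp
    moreover have "M' = d\<^sup>2 + 2 * (d * R) - 3 * (R * R)" "b\<^sup>2 = a\<^sup>2 + a * R / 2 + R * R / 16"
      by (simp_all add: M'_def b_def power2_eq_square algebra_simps)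
    ultimately show ?thesis using M unfolding d_def power2_eq_square[of R] by linarith
  qed
  have "0 < a * R" using a0 R by simp
  then have bM: "b\<^sup>2 \<le> M'" using M'b by linarith
  have v0: "0 < v" using vw a0 by (metis zero_less_power less_le_trans)
  have "(?g w - ?g v) * (M' - b\<^sup>2) \<le> (?g M' - ?g (b\<^sup>2)) * (w - v)"
    using v0 vw bM R by (intro convex_on_slopes[OF convex_on_disk_share[of "2 * R" y']]) (auto simp: ny' M'_def b_def)
  also have "\<dots> \<le> 1 * (w - v)"
    using vw disk_share_le_1[of "2 * R" y' M'] disk_share_nonneg[of y' "2 * R" "b\<^sup>2"] R
    by (intro mult_right_mono) auto
  finally have "(?g w - ?g v) * (M' - b\<^sup>2) \<le> w - v" by simp
  moreover have "(?g w - ?g v) * (8/25 * (a * R)) \<le> (?g w - ?g v) * (M' - b\<^sup>2)"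
    using M'b vw by (intro mult_left_mono) (auto simp: disk_share_mono)
  ultimately have 2: "8/25 * (a * R) * (?g w - ?g v) \<le> w - v" by (simp add: mult.commute)
  have "2 * a * R * (disk_share y R w - disk_share y R v) \<le> 2 * a * R * (4 * (?g w - ?g v))"
    using 1 a0 R by (intro mult_left_mono) auto
  also have "\<dots> = 25 * (8/25 * (a * R) * (?g w - ?g v))" by simp
  also have "\<dots> \<le> 25 * (w - v)" using 2 by (intro mult_left_mono) auto
  finally show ?thesis .
qed

section \<open>Time spent away from the even integers\<close>

lemma borel_preimage_Icc:
  fixes P :: "real \<Rightarrow> real"
  assumes "continuous_on {a..b} P" "T \<in> sets borel"
  shows "{v \<in> {a..b}. P v \<in> T} \<in> sets borel"
proof -
  have "P \<in> borel_measurable (restrict_space borel {a..b})"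
    by (rule borel_measurable_continuous_on_restrict[OF assms(1)])
  from measurable_sets[OF this assms(2)]
  have "P -` T \<inter> {a..b} \<in> sets (restrict_space borel {a..b})"
    by (simp add: space_restrict_space)
  then have "P -` T \<inter> {a..b} \<in> sets borel"
    by (subst (asm) sets_restrict_space_iff) auto
  moreover have "P -` T \<inter> {a..b} = {v \<in> {a..b}. P v \<in> T}" by auto
  ultimately show ?thesis by simp
qed

lemma fmeasurable_Icc: "{a..b::real} \<in> fmeasurable lborel"
  using emeasure_bounded_finite[OF bounded_closed_interval, of a b] by (intro fmeasurableI) auto

lemma fmeasurable_subset_Icc:
  fixes a b :: real
  assumes "S \<in> sets borel" "S \<subseteq> {a..b}"
  shows "S \<in> fmeasurable lborel"
  by (rule fmeasurableI2[OF fmeasurable_Icc]) (use assms in auto)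

lemma measure_le_diameter:
  fixes S :: "real set"
  assumes "S \<subseteq> {a..b}" "S \<in> sets borel" "0 \<le> T"
    and diam: "\<And>x y. x \<in> S \<Longrightarrow> y \<in> S \<Longrightarrow> x \<le> y \<Longrightarrow> y - x \<le> T"
  shows "measure lborel S \<le> T"
proof (cases "S = {}")
  case False
  have bdd: "bdd_below S" using assms(1) by (meson bdd_below_Icc bdd_below_mono)
  have sub: "S \<subseteq> {Inf S..Inf S + T}"
  proof
    fix y assume y: "y \<in> S"
    have "y - T \<le> Inf S"
    proof (rule cInf_greatest[OF False])
      fix x assume "x \<in> S"
      then show "y - T \<le> x" using diam[of x y] y assms(3) by (cases "x \<le> y") auto
    qed
    then show "y \<in> {Inf S..Inf S + T}" using cInf_lower[OF y bdd] by simp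
  qed
  then have "measure lborel S \<le> measure lborel {Inf S..Inf S + T}"
    using assms(2) by (intro measure_mono_fmeasurable fmeasurable_Icc) auto
  then show ?thesis using assms(3) by simp
qed (use assms(3) in simp)

text \<open>The gap below an even integer is crossed before that integer is passed, so the slope hypothesis
  bounds the time of passage by the time spent in the gap; only the first passage has no such gap.\<close>
lemma measure_away_from_even_ge:
  fixes P :: "real \<Rightarrow> real" and c K T :: real
  assumes ab: "a \<le> b" and cont: "continuous_on {a..b} P"
    and mono: "\<And>x y. a \<le> x \<Longrightarrow> x \<le> y \<Longrightarrow> y \<le> b \<Longrightarrow> P x \<le> P y"
    and c: "0 < c" "c < 1" and K: "0 \<le> K" and T: "0 \<le> T"
    and slopes: "\<And>s t x y. a \<le> s \<Longrightarrow> s \<le> t \<Longrightarrow> t \<le> x \<Longrightarrow> x \<le> y \<Longrightarrow> y \<le> b \<Longrightarrow>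
      (y - x) * (P t - P s) \<le> K * (t - s) * (P y - P x)"
    and short: "\<And>k::int. \<And>x y. a \<le> x \<Longrightarrow> y \<le> b \<Longrightarrow> \<forall>v\<in>{x..y}. \<bar>P v - 2 * of_int k\<bar> < c \<Longrightarrow> y - x \<le> T"
  shows "b - a \<le> T + (1 + K * c / (1 - c)) * measure lborel {v \<in> {a..b}. \<forall>k::int. c \<le> \<bar>P v - 2 * of_int k\<bar>}"
proof -
  define G where "G = {v \<in> {a..b}. \<forall>k::int. c \<le> \<bar>P v - 2 * of_int k\<bar>}"
  \<comment> \<open>\<open>B j\<close> is the passage near \<open>2 j\<close>, \<open>J j\<close>
    the crossing of the gap below it. Monotonicity of \<open>P\<close> leaves only the indices from
    \<open>k\<close>, the least one with \<open>P a < 2 k + c\<close>, up to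
    \<open>m\<close>.\<close>
  define B where "B = (\<lambda>j::int. {v \<in> {a..b}. \<bar>P v - 2 * of_int j\<bar> < c})"
  define J where "J = (\<lambda>j::int. {v \<in> {a..b}. 2 * of_int j - 2 + c \<le> P v \<and> P v \<le> 2 * of_int j - c})"
  define k where "k = \<lfloor>(P a - c) / 2\<rfloor> + 1"
  define m where "m = \<lceil>(P b + c) / 2\<rceil>"
  define C where "C = K * c / (1 - c)"
  have C0: "0 \<le> C" using K c by (simp add: C_def)
  have Pa: "P a < 2 * of_int k + c"
  proof -
    have "(P a - c) / 2 < of_int k" unfolding k_def by linarith
    then show ?thesis by (simp add: field_simps)
  qed
  have Beq: "B j = {v \<in> {a..b}. P v \<in> {2 * of_int j - c<..<2 * of_int j + c}}" for j
    unfolding B_def by (rule Collect_cong) (auto simp: abs_less_iff)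
  have Jeq: "J j = {v \<in> {a..b}. P v \<in> {2 * of_int j - 2 + c..2 * of_int j - c}}" for j
    unfolding J_def by (rule Collect_cong) simp
  have sets: "B j \<in> sets borel" "J j \<in> sets borel" for j
    unfolding Beq Jeq by (rule borel_preimage_Icc[OF cont], simp)+
  have Geq: "G = {a..b} - (\<Union>j. B j)" unfolding G_def B_def not_less[symmetric] by blast
  have setsG: "G \<in> sets borel" unfolding Geq using sets by (intro sets.Diff sets.countable_UN) auto
  have fm: "G \<in> fmeasurable lborel" "B j \<in> fmeasurable lborel" "J j \<in> fmeasurable lborel" for j
    by (rule fmeasurable_subset_Icc[of _ a b], use setsG sets in simp, simp add: G_def B_def J_def subset_iff)+
  have cover: "{a..b} \<subseteq> (G \<union> B k) \<union> (\<Union>j\<in>{k+1..m}. B j)"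
  proof
    fix v assume v: "v \<in> {a..b}"
    show "v \<in> (G \<union> B k) \<union> (\<Union>j\<in>{k+1..m}. B j)"
    proof (cases "v \<in> G")
      case False
      then obtain j :: int where j: "\<bar>P v - 2 * of_int j\<bar> < c" using v by (auto simp: G_def not_le)
      have "P a \<le> P v" "P v \<le> P b" using mono v by auto
      then have "(P a - c) / 2 < of_int j" "of_int j < (P b + c) / 2" using j by (auto simp: field_simps)
      then have "k \<le> j" "j \<le> m" unfolding k_def m_def by linarith+
      then show ?thesis using j v by (cases "j = k") (auto simp: B_def)
    qed auto
  qed
  have Bk: "measure lborel (B k) \<le> T"
  proof (rule measure_le_diameter[where a = a and b = b])
    fix x y assume xy: "x \<in> B k" "y \<in> B k" "x \<le> y"
    have "\<bar>P v - 2 * of_int k\<bar> < c" if "v \<in> {x..y}" for v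
    proof -
      have "P x \<le> P v" "P v \<le> P y" using xy that by (auto simp: B_def intro: mono)
      moreover have "\<bar>P x - 2 * of_int k\<bar> < c" "\<bar>P y - 2 * of_int k\<bar> < c" using xy by (auto simp: B_def)
      ultimately show ?thesis by linarith
    qed
    then have all: "\<forall>v\<in>{x..y}. \<bar>P v - 2 * of_int k\<bar> < c" by blast
    show "y - x \<le> T" by (rule short[OF _ _ all]) (use xy in \<open>auto simp: B_def\<close>)
  qed (use sets(1)[of k] T in \<open>simp_all add: B_def subset_iff\<close>)
  have BJ: "measure lborel (B j) \<le> C * measure lborel (J j)" if "k + 1 \<le> j" for j
  proof (cases "B j = {}")
    case False
    then obtain v where vB: "v \<in> B j" by blast
    then have v: "v \<in> {a..b}" "2 * of_int j - c < P v" by (simp_all add: B_def abs_less_iff)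
    have kj: "of_int k + 1 \<le> (of_int j :: real)" using that by linarith
    have cv: "continuous_on {a..v} P" using cont v(1) by (rule_tac continuous_on_subset) auto
    \<comment> \<open>For \<open>j > k\<close> the function starts below the gap and at
      \<open>v\<close> is already above it, so it crosses the whole gap, exactly on
      \<open>[s, t]\<close>.\<close>
    have "\<exists>s\<ge>a. s \<le> v \<and> P s = 2 * of_int j - 2 + c"
    proof (rule IVT'[OF _ _ _ cv])
      show "P a \<le> 2 * of_int j - 2 + c" using Pa kj by linarith
      show "2 * of_int j - 2 + c \<le> P v" using v(2) c by linarith
    qed (use v(1) in simp)
    then obtain s where s: "a \<le> s" "s \<le> v" "P s = 2 * of_int j - 2 + c" by blast
    have "\<exists>t\<ge>s. t \<le> v \<and> P t = 2 * of_int j - c"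
    proof (rule IVT')
      show "P s \<le> 2 * of_int j - c" using s(3) c by linarith
      show "2 * of_int j - c \<le> P v" using v(2) by linarith
      show "continuous_on {s..v} P" by (rule continuous_on_subset[OF cv]) (use s(1) in simp)
    qed (rule s(2))
    then obtain t where t: "s \<le> t" "t \<le> v" "P t = 2 * of_int j - c" by blast
    have "{s..t} \<subseteq> J j"
    proof
      fix z assume z: "z \<in> {s..t}"
      have "P s \<le> P z" by (rule mono) (use z s(1) t(2) v(1) in auto)
      moreover have "P z \<le> P t" by (rule mono) (use z s(1) t(2) v(1) in auto)
      moreover have "a \<le> z" "z \<le> b" using z s(1) t(2) v(1) by auto
      ultimately show "z \<in> J j" unfolding J_def s(3) t(3) by simp
    qed
    then have ts: "t - s \<le> measure lborel (J j)"
      using measure_mono_fmeasurable[of "{s..t}" "J j" lborel] fm(3)[of j] t(1) by simp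
    have "measure lborel (B j) \<le> C * (t - s)"
    proof (rule measure_le_diameter[where a = a and b = b])
      fix x y assume xy: "x \<in> B j" "y \<in> B j" "x \<le> y"
      have B: "\<bar>P x - 2 * of_int j\<bar> < c" "\<bar>P y - 2 * of_int j\<bar> < c" using xy by (auto simp: B_def)
      have x: "a \<le> x" "y \<le> b" using xy by (auto simp: B_def)
      have Px: "P t < P x" "P y - P x \<le> 2 * c" using B t(3) by linarith+
      have tx: "t \<le> x"
      proof (rule ccontr)
        assume "\<not> t \<le> x"
        then have "P x \<le> P t" using x(1) t(2) v(1) by (intro mono) auto
        then show False using Px(1) by simp
      qed
      \<comment> \<open>\<open>P\<close> rises by \<open>2 (1 - c)\<close> on \<open>[s, t]\<close>
        and by at most \<open>2 c\<close> on \<open>[x, y]\<close>; this is the source of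
        \<open>K * c / (1 - c)\<close>.\<close>
      have "(y - x) * (P t - P s) \<le> K * (t - s) * (P y - P x)"
        by (rule slopes[OF s(1) t(1) tx xy(3) x(2)])
      also have "\<dots> \<le> K * (t - s) * (2 * c)" using K t(1) Px(2) by (intro mult_left_mono) auto
      finally have "2 * ((y - x) * (1 - c)) \<le> 2 * (K * (t - s) * c)"
        unfolding s(3) t(3) by (simp add: algebra_simps)
      then have "(y - x) * (1 - c) \<le> K * (t - s) * c" by linarith
      then show "y - x \<le> C * (t - s)" using c by (simp add: C_def pos_le_divide_eq mult_ac)
    qed (use sets(1)[of j] C0 t(1) in \<open>simp_all add: B_def subset_iff\<close>)
    also have "\<dots> \<le> C * measure lborel (J j)" using ts C0 by (rule mult_left_mono)
    finally show ?thesis .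
  qed (use C0 in simp)
  \<comment> \<open>The crossings are disjoint and avoid all passages, so their total time is at
    most that of \<open>G\<close>.\<close>
  have "(\<Sum>j=k+1..m. measure lborel (J j)) = measure lborel (\<Union>j\<in>{k+1..m}. J j)"
  proof (rule measure_finite_Union[symmetric])
    show "disjoint_family_on J {k+1..m}"
    proof (unfold disjoint_family_on_def, intro ballI impI)
      fix i j :: int assume "i \<noteq> j"
      have False if "v \<in> J i" "v \<in> J j" for v
      proof -
        have "2 * of_int i - 2 + c \<le> P v" "P v \<le> 2 * of_int i - c"
          "2 * of_int j - 2 + c \<le> P v" "P v \<le> 2 * of_int j - c"
          using that by (auto simp: J_def)
        then have "(of_int i :: real) < of_int j + 1" "(of_int j :: real) < of_int i + 1"
          using c by linarith+
        then show False using \<open>i \<noteq> j\<close> by linarith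
      qed
      then show "J i \<inter> J j = {}" by blast
    qed
  qed (use fmeasurableD2[OF fm(3)] sets in auto)
  also have "\<dots> \<le> measure lborel G"
  proof (rule measure_mono_fmeasurable)
    show "(\<Union>j\<in>{k+1..m}. J j) \<subseteq> G"
    proof
      fix v assume "v \<in> (\<Union>j\<in>{k+1..m}. J j)"
      then obtain j where j: "v \<in> J j" by blast
      have "c \<le> \<bar>P v - 2 * of_int i\<bar>" for i :: int
      proof (cases "i < j")
        case True
        then have "(of_int i :: real) \<le> of_int j - 1" by linarith
        then show ?thesis using j unfolding J_def by auto
      next
        case False
        then have "(of_int j :: real) \<le> of_int i" by linarith
        then show ?thesis using j unfolding J_def by auto
      qed
      then show "v \<in> G" using j by (auto simp: G_def J_def)
    qed
  qed (use fm sets in auto)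
  finally have JG: "(\<Sum>j=k+1..m. measure lborel (J j)) \<le> measure lborel G" .
  have "b - a = measure lborel {a..b}" using ab by simp
  also have "\<dots> \<le> measure lborel ((G \<union> B k) \<union> (\<Union>j\<in>{k+1..m}. B j))"
    by (rule measure_mono_fmeasurable[OF cover]) (auto intro!: fmeasurable.Un fmeasurable.finite_UN fm)
  also have "\<dots> \<le> measure lborel (G \<union> B k) + measure lborel (\<Union>j\<in>{k+1..m}. B j)"
    by (rule measure_Un_le) (use setsG sets in auto)
  also have "measure lborel (G \<union> B k) \<le> measure lborel G + measure lborel (B k)"
    by (rule measure_Un_le) (use setsG sets in auto)
  also have "measure lborel (\<Union>j\<in>{k+1..m}. B j) \<le> (\<Sum>j=k+1..m. measure lborel (B j))"
    by (rule measure_UNION_le) (use sets in auto)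
  also have "\<dots> \<le> (\<Sum>j=k+1..m. C * measure lborel (J j))"
    by (rule sum_mono) (use BJ in auto)
  also have "\<dots> = C * (\<Sum>j=k+1..m. measure lborel (J j))" by (simp add: sum_distrib_left)
  also have "\<dots> \<le> C * measure lborel G" using JG C0 by (rule mult_left_mono)
  finally have "b - a \<le> measure lborel G + measure lborel (B k) + C * measure lborel G" by simp
  then have "b - a \<le> T + (1 + C) * measure lborel G" using Bk by (simp add: algebra_simps)
  then show ?thesis by (simp add: C_def G_def)
qed

text \<open>Reflection: \<open>- P (- v)\<close> is again monotone, the order of the two compared
  intervals is reversed, and even integers go to even integers.\<close>

lemma measure_away_from_even_ge_left:
  fixes P :: "real \<Rightarrow> real" and c K T :: real
  assumes ab: "a \<le> b" and cont: "continuous_on {a..b} P"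
    and mono: "\<And>x y. a \<le> x \<Longrightarrow> x \<le> y \<Longrightarrow> y \<le> b \<Longrightarrow> P x \<le> P y"
    and c: "0 < c" "c < 1" and K: "0 \<le> K" and T: "0 \<le> T"
    and slopes: "\<And>s t x y. a \<le> x \<Longrightarrow> x \<le> y \<Longrightarrow> y \<le> s \<Longrightarrow> s \<le> t \<Longrightarrow> t \<le> b \<Longrightarrow>
      (y - x) * (P t - P s) \<le> K * (t - s) * (P y - P x)"
    and short: "\<And>k::int. \<And>x y. a \<le> x \<Longrightarrow> y \<le> b \<Longrightarrow> \<forall>v\<in>{x..y}. \<bar>P v - 2 * of_int k\<bar> < c \<Longrightarrow> y - x \<le> T"
  shows "b - a \<le> T + (1 + K * c / (1 - c)) * measure lborel {v \<in> {a..b}. \<forall>k::int. c \<le> \<bar>P v - 2 * of_int k\<bar>}"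
proof -
  define G where "G = {v \<in> {a..b}. \<forall>k::int. c \<le> \<bar>P v - 2 * of_int k\<bar>}"
  have flip: "\<bar>- p - 2 * of_int k\<bar> = \<bar>p - 2 * of_int (- k)\<bar>" for p :: real and k :: int by simp
  have "- a - - b \<le> T + (1 + K * c / (1 - c)) *
    measure lborel {v \<in> {- b..- a}. \<forall>k::int. c \<le> \<bar>- P (- v) - 2 * of_int k\<bar>}"
  proof (rule measure_away_from_even_ge)
    show "continuous_on {- b..- a} (\<lambda>v. - P (- v))"
      by (intro continuous_intros continuous_on_compose2[OF cont]) auto
    show "- P (- x) \<le> - P (- y)" if "- b \<le> x" "x \<le> y" "y \<le> - a" for x y
      using mono[of "- y" "- x"] that by simp
    show "(y - x) * (- P (- t) - - P (- s)) \<le> K * (t - s) * (- P (- y) - - P (- x))"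
      if "- b \<le> s" "s \<le> t" "t \<le> x" "x \<le> y" "y \<le> - a" for s t x y
      using slopes[of "- y" "- x" "- t" "- s"] that by simp
    show "y - x \<le> T" if *: "- b \<le> x" "y \<le> - a" "\<forall>v\<in>{x..y}. \<bar>- P (- v) - 2 * of_int k\<bar> < c" for k x y
    proof -
      have "\<bar>P v - 2 * of_int (- k)\<bar> < c" if "v \<in> {- y..- x}" for v
        using *(3)[rule_format, of "- v"] that unfolding flip by simp
      then have "- x - - y \<le> T" using * by (intro short[of "- y" "- x" "- k"]) auto
      then show ?thesis by simp
    qed
  qed (use ab c K T in auto)
  also have "{v \<in> {- b..- a}. \<forall>k::int. c \<le> \<bar>- P (- v) - 2 * of_int k\<bar>} = (*\<^sub>R) (-1) ` G"
  proof (intro set_eqI iffI)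
    fix v assume v: "v \<in> {v \<in> {- b..- a}. \<forall>k::int. c \<le> \<bar>- P (- v) - 2 * of_int k\<bar>}"
    have "c \<le> \<bar>P (- v) - 2 * of_int k\<bar>" for k :: int
    proof -
      have "c \<le> \<bar>- P (- v) - 2 * of_int (- k)\<bar>" using v by blast
      then show ?thesis unfolding flip by simp
    qed
    then have "- v \<in> G" using v by (auto simp: G_def)
    then show "v \<in> (*\<^sub>R) (-1) ` G" by (rule rev_image_eqI) simp
  next
    fix v assume "v \<in> (*\<^sub>R) (-1) ` G"
    then obtain w where w: "w \<in> G" "v = - w" by auto
    have "c \<le> \<bar>- P w - 2 * of_int k\<bar>" for k :: int
      unfolding flip using w(1) unfolding G_def by blast
    then show "v \<in> {v \<in> {- b..- a}. \<forall>k::int. c \<le> \<bar>- P (- v) - 2 * of_int k\<bar>}"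
      using w by (auto simp: G_def)
  qed
  also have "measure lborel ((*\<^sub>R) (-1) ` G) = measure lborel G"
  proof -
    have "G = (\<Inter>k::int. {v \<in> {a..b}. P v \<in> {p. c \<le> \<bar>p - 2 * of_int k\<bar>}})"
      by (auto simp: G_def)
    also have "\<dots> \<in> sets borel"
      by (intro sets.countable_INT'' borel_preimage_Icc[OF cont]) auto
    finally show ?thesis by (subst measure_lborel_scaleR_image) auto
  qed
  finally show ?thesis by (simp add: G_def)
qed

section \<open>Combining convex, concave and comparable shares\<close>

lemma convex_on_min_split:
  fixes D :: "real \<Rightarrow> real"
  assumes conv: "convex_on {p..q} D" and cont: "continuous_on {p..q} D" and pq: "p \<le> q"
  obtains z where "z \<in> {p..q}"
    and "\<And>v w. z \<le> v \<Longrightarrow> v \<le> w \<Longrightarrow> w \<le> q \<Longrightarrow> D v \<le> D w"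
    and "\<And>v w. p \<le> v \<Longrightarrow> v \<le> w \<Longrightarrow> w \<le> z \<Longrightarrow> D w \<le> D v"
proof -
  have "\<exists>z\<in>{p..q}. \<forall>v\<in>{p..q}. D z \<le> D v"
    by (rule continuous_attains_inf[OF compact_Icc _ cont]) (use pq in simp)
  then obtain z where z: "z \<in> {p..q}" "\<forall>v\<in>{p..q}. D z \<le> D v" by blast
  \<comment> \<open>A nonnegative slope from the minimiser \<open>z\<close> to \<open>v\<close>
    forces nonnegative slopes from \<open>v\<close> on; the left side is symmetric.\<close>
  have 1: "D v \<le> D w" if vw: "z \<le> v" "v \<le> w" "w \<le> q" for v w
  proof (cases "v = z")
    case True
    then show ?thesis using z that by auto
  next
    case False
    have "(D v - D z) * (w - v) \<le> (D w - D v) * (v - z)"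
      using z(1) vw by (intro convex_on_slopes[OF conv]) auto
    moreover have "0 \<le> (D v - D z) * (w - v)" using z vw by (intro mult_nonneg_nonneg) auto
    ultimately have "0 \<le> (D w - D v) * (v - z)" by linarith
    then show ?thesis using False vw(1) by (simp add: zero_le_mult_iff)
  qed
  have 2: "D w \<le> D v" if vw: "p \<le> v" "v \<le> w" "w \<le> z" for v w
  proof (cases "w = z")
    case True
    then show ?thesis using z that by auto
  next
    case False
    have "(D w - D v) * (z - w) \<le> (D z - D w) * (w - v)"
      using z(1) vw by (intro convex_on_slopes[OF conv]) auto
    moreover have "(D z - D w) * (w - v) \<le> 0" using z vw by (intro mult_nonpos_nonneg) auto
    ultimately have "(D w - D v) * (z - w) \<le> 0" by linarith
    then show ?thesis using False vw(3) by (simp add: mult_le_0_iff)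
  qed
  show thesis by (rule that[OF z(1) 1 2])
qed

text \<open>All slopes in the window lie between \<open>1 / (96 a R)\<close> and
  \<open>25 / (2 a R)\<close>, with ratio 1200, so the two intervals may come in any order.\<close>

lemma disk_share_slopes_comparable:
  assumes R: "0 < R" and a: "7/4 * R \<le> a"
    and M: "a\<^sup>2 \<le> (norm y)\<^sup>2 - R\<^sup>2" "(norm y)\<^sup>2 - R\<^sup>2 \<le> (a + R/4)\<^sup>2"
    and st: "a\<^sup>2 \<le> s" "s \<le> t" "t \<le> (a + R/4)\<^sup>2"
    and vw: "a\<^sup>2 \<le> v" "v \<le> w" "w \<le> (a + R/4)\<^sup>2"
  shows "(w - v) * (disk_share y R t - disk_share y R s) \<le> 1200 * ((t - s) * (disk_share y R w - disk_share y R v))"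
proof -
  let ?g = "disk_share y R t - disk_share y R s" and ?h = "disk_share y R w - disk_share y R v"
  have aR: "0 < a * R" using a R by simp
  have "2 * (a * R) * ((w - v) * ?g) = (w - v) * (2 * a * R * ?g)" by simp
  also have "\<dots> \<le> (w - v) * (25 * (t - s))"
    using disk_share_slope_le[OF R a M(1) st] vw by (intro mult_left_mono) auto
  also have "\<dots> = 25 * (t - s) * (w - v)" by simp
  also have "\<dots> \<le> 25 * (t - s) * (96 * a * R * ?h)"
    using disk_share_slope_ge[OF R a M vw] st by (intro mult_left_mono) auto
  also have "\<dots> = 2 * (a * R) * (1200 * ((t - s) * ?h))" by algebra
  finally show ?thesis using aR by (rule_tac mult_left_le_imp_le[of "2 * (a * R)"]) auto
qed

text \<open>The density estimate that feeds the Poincare argument. The passage lemmas are applied on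
  that side of a splitting point which is long enough.\<close>

lemma measure_flux_away_from_even_ge:
  fixes y :: "'i \<Rightarrow> real^2" and A \<beta> :: real
  assumes R: "0 < R" and a: "7/4 * R \<le> a" and I: "finite I" and A: "0 \<le> A"
    and b: "0 < \<beta>" "\<beta> \<le> 1"
    and away: "\<And>(p::nat) (k::int). p \<le> card I \<Longrightarrow> \<beta> \<le> \<bar>A * (1 + 2 * real p) - 2 * of_int k\<bar>"
  defines "P \<equiv> \<lambda>r. A * (1 + 2 * (\<Sum>l\<in>I. disk_share (y l) R (r\<^sup>2)))"
  shows "R / 192 \<le> measure lborel {r \<in> {a..a + R/4}. \<forall>k::int. \<beta> / 130 \<le> \<bar>P r - 2 * of_int k\<bar>}"
proof -
  define b where "b = a + R/4"
  define c where "c = \<beta> / 130"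
  define M where "M = (\<lambda>l. (norm (y l))\<^sup>2 - R\<^sup>2)"
  define f where "f = (\<lambda>l. disk_share (y l) R)"
  define S where "S = (\<lambda>v. \<Sum>l\<in>I. f l v)"
  have PS: "P r = A * (1 + 2 * S (r\<^sup>2))" for r by (simp add: P_def S_def f_def)
  have a0: "0 < a" using a R by linarith
  have ab: "a \<le> b" using R by (simp add: b_def)
  have c: "0 < c" "c < 1" "130 * c \<le> 1" using b by (auto simp: c_def)
  have contf: "continuous_on {a\<^sup>2..b\<^sup>2} (f l)" for l
    unfolding f_def by (rule continuous_on_subset[OF continuous_on_disk_share[OF R]]) (auto intro: order_trans[OF zero_le_power2])
  have monof: "f l v \<le> f l w" if "v \<le> w" for l v w
    using that by (simp add: f_def disk_share_mono)
  have contP: "continuous_on {a..b} P"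
    unfolding P_def using continuous_on_disk_share[OF R]
    by (intro continuous_intros continuous_on_compose2[OF continuous_on_disk_share[OF R]]) auto
  have monoS: "S v \<le> S w" if "v \<le> w" for v w
    unfolding S_def using that by (intro sum_mono monof)
  have monoP: "P x \<le> P w" if "a \<le> x" "x \<le> w" for x w
  proof -
    have "x\<^sup>2 \<le> w\<^sup>2" using that a0 by (intro power_mono) auto
    then show ?thesis unfolding PS using A monoS by (intro mult_left_mono) auto
  qed

  have short: "w - x \<le> R / 16"
    if xw: "a \<le> x" "w \<le> b" and bad: "\<forall>v\<in>{x..w}. \<bar>P v - 2 * of_int k\<bar> < c" for k :: int and x w
  proof (rule ccontr)
    assume long: "\<not> w - x \<le> R / 16"
    define r where "r = (x + w) / 2"
    \<comment> \<open>Half of the length \<open>R / 16\<close>, so that the factor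
      \<open>2 * R / h\<close> is 64.\<close>
    define h where "h = R / 32"
    have rh: "x \<le> r - h" "r + h \<le> w" "x \<le> r" "r \<le> w" using long R unfolding r_def h_def by (simp_all add: field_simps)
    have h: "0 < h" "h \<le> R" "2 * R / h = 64" using R by (auto simp: h_def)
    have ar: "7/4 * R \<le> r" using a xw rh by linarith
    have "\<forall>l\<in>I. \<exists>e\<in>{0,1}. \<bar>f l (r\<^sup>2) - e\<bar> \<le> 64 * (f l ((r + h)\<^sup>2) - f l ((r - h)\<^sup>2))"
      using disk_share_near_01[OF R h(1,2) ar] unfolding h(3) f_def by blast
    then obtain e where e: "\<And>l. l \<in> I \<Longrightarrow> e l \<in> {0,1::real}"
      "\<And>l. l \<in> I \<Longrightarrow> \<bar>f l (r\<^sup>2) - e l\<bar> \<le> 64 * (f l ((r + h)\<^sup>2) - f l ((r - h)\<^sup>2))"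
      by metis
    \<comment> \<open>The number of disks that count as covered.\<close>
    define p where "p = card {l \<in> I. e l = 1}"
    have "(\<Sum>l\<in>I. e l) = (\<Sum>l\<in>I. if e l = 1 then 1 else 0)"
      using e(1) by (intro sum.cong) auto
    also have "\<dots> = real p" using I by (simp add: p_def sum.If_cases Int_def)
    finally have sume: "(\<Sum>l\<in>I. e l) = real p" .
    have p: "p \<le> card I" unfolding p_def using I by (intro card_mono) auto
    have "\<bar>S (r\<^sup>2) - real p\<bar> = \<bar>\<Sum>l\<in>I. f l (r\<^sup>2) - e l\<bar>"
      by (simp add: S_def sume[symmetric] sum_subtractf)
    also have "\<dots> \<le> (\<Sum>l\<in>I. \<bar>f l (r\<^sup>2) - e l\<bar>)" by (rule sum_abs)
    also have "\<dots> \<le> (\<Sum>l\<in>I. 64 * (f l ((r + h)\<^sup>2) - f l ((r - h)\<^sup>2)))"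
      using e(2) by (rule sum_mono)
    also have "\<dots> = 64 * (S ((r + h)\<^sup>2) - S ((r - h)\<^sup>2))"
      by (simp add: S_def sum_distrib_left[symmetric] sum_subtractf)
    finally have "2 * A * \<bar>S (r\<^sup>2) - real p\<bar> \<le> 2 * A * (64 * (S ((r + h)\<^sup>2) - S ((r - h)\<^sup>2)))"
      using A by (intro mult_left_mono) auto
    also have "\<dots> = 64 * (P (r + h) - P (r - h))" by (simp add: PS algebra_simps)
    also have "2 * A * \<bar>S (r\<^sup>2) - real p\<bar> = \<bar>2 * A * (S (r\<^sup>2) - real p)\<bar>" using A by (simp add: abs_mult)
    also have "2 * A * (S (r\<^sup>2) - real p) = P r - A * (1 + 2 * real p)" by (simp add: PS algebra_simps)
    finally have 1: "\<bar>P r - A * (1 + 2 * real p)\<bar> \<le> 64 * (P (r + h) - P (r - h))" .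
    have "\<bar>P (r + h) - 2 * of_int k\<bar> < c" "\<bar>P (r - h) - 2 * of_int k\<bar> < c" "\<bar>P r - 2 * of_int k\<bar> < c"
      using bad rh h by auto
    then have "P (r + h) - P (r - h) < 2 * c" "\<bar>P r - 2 * of_int k\<bar> < c" by (auto simp: abs_less_iff)
    note bnd = this
    define q where "q = A * (1 + 2 * real p)"
    have "\<bar>P r - q\<bar> \<le> 64 * (P (r + h) - P (r - h))" using 1 by (simp only: q_def)
    also have "\<dots> < 64 * (2 * c)" using bnd(1) by simp
    \<comment> \<open>\<open>128 c\<close> comes from the near constancy of the flux and
      \<open>c\<close> from its being close to \<open>2 k\<close>; the total is below
      \<open>130 c = \<beta>\<close>.\<close>
    finally have "\<bar>q - 2 * of_int k\<bar> < 130 * c" using bnd(2) c(1) unfolding abs_less_iff by simp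
    then show False using away[OF p, of k] by (simp add: c_def q_def)
  qed

  \<comment> \<open>The disks are sorted by their inflection \<open>M l\<close>: beyond the window
    (convex share), before it (concave share), or inside it (comparable slopes).\<close>
  define I1 where "I1 = {l \<in> I. b\<^sup>2 \<le> M l}"
  define I2 where "I2 = {l \<in> I. M l < b\<^sup>2 \<and> M l \<le> a\<^sup>2}"
  define I3 where "I3 = {l \<in> I. M l < b\<^sup>2 \<and> a\<^sup>2 < M l}"
  have split: "S v = sum (\<lambda>l. f l v) I1 + sum (\<lambda>l. f l v) I2 + sum (\<lambda>l. f l v) I3" for v
  proof -
    have "I = (I1 \<union> I2) \<union> I3" unfolding I1_def I2_def I3_def by auto
    moreover have "sum (\<lambda>l. f l v) ((I1 \<union> I2) \<union> I3) = sum (\<lambda>l. f l v) (I1 \<union> I2) + sum (\<lambda>l. f l v) I3"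
      using I by (intro sum.union_disjoint) (auto simp: I1_def I2_def I3_def)
    moreover have "sum (\<lambda>l. f l v) (I1 \<union> I2) = sum (\<lambda>l. f l v) I1 + sum (\<lambda>l. f l v) I2"
      using I by (intro sum.union_disjoint) (auto simp: I1_def I2_def)
    ultimately show ?thesis unfolding S_def by simp
  qed
  define X where "X = (\<lambda>v. sum (\<lambda>l. f l v) I1)"
  define Y where "Y = (\<lambda>v. sum (\<lambda>l. f l v) I2)"
  define Z where "Z = (\<lambda>v. sum (\<lambda>l. f l v) I3)"
  have SXYZ: "S v = X v + Y v + Z v" for v by (simp add: split X_def Y_def Z_def)
  have monoXYZ: "X v \<le> X w" "Y v \<le> Y w" "Z v \<le> Z w" if "v \<le> w" for v w
    unfolding X_def Y_def Z_def using that by (auto intro!: sum_mono monof)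
  have a2: "0 < a\<^sup>2" using a0 by simp
  have convX: "convex_on {a\<^sup>2..b\<^sup>2} X"
    unfolding X_def
  proof (rule convex_on_setsum)
    fix l assume "l \<in> I1"
    then show "convex_on {a\<^sup>2..b\<^sup>2} (f l)"
      unfolding f_def
      by (intro convex_on_subset[OF convex_on_disk_share[OF R]]) (auto simp: I1_def M_def intro: less_le_trans[OF a2])
  qed simp
  have concY: "concave_on {a\<^sup>2..b\<^sup>2} Y"
    unfolding Y_def concave_on_def sum_negf[symmetric]
  proof (rule convex_on_setsum)
    fix l assume "l \<in> I2"
    then have "concave_on {a\<^sup>2..b\<^sup>2} (f l)"
      unfolding f_def using concave_on_disk_share[OF R, of "y l"] unfolding concave_on_def
      by (rule_tac convex_on_subset) (auto simp: I2_def M_def intro: less_le_trans[OF a2])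
    then show "convex_on {a\<^sup>2..b\<^sup>2} (\<lambda>v. - f l v)" by (simp add: concave_on_def)
  qed simp
  have Zcomp: "(w - v) * (Z t - Z s) \<le> 1200 * ((t - s) * (Z w - Z v))"
    if "a\<^sup>2 \<le> s" "s \<le> t" "t \<le> b\<^sup>2" "a\<^sup>2 \<le> v" "v \<le> w" "w \<le> b\<^sup>2" for s t v w
  proof -
    have "(w - v) * (Z t - Z s) = (\<Sum>l\<in>I3. (w - v) * (f l t - f l s))"
      by (simp add: Z_def sum_subtractf sum_distrib_left[symmetric])
    also have "\<dots> \<le> (\<Sum>l\<in>I3. 1200 * ((t - s) * (f l w - f l v)))"
      unfolding f_def using that
      by (intro sum_mono disk_share_slopes_comparable[OF R a]) (auto simp: I3_def M_def b_def)
    also have "\<dots> = 1200 * ((t - s) * (Z w - Z v))"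
      by (simp add: Z_def sum_subtractf sum_distrib_left[symmetric])
    finally show ?thesis .
  qed
  have convD: "convex_on {a\<^sup>2..b\<^sup>2} (\<lambda>v. X v - Y v)" by (rule convex_on_diff[OF convX concY])
  have contD: "continuous_on {a\<^sup>2..b\<^sup>2} (\<lambda>v. X v - Y v)"
    unfolding X_def Y_def by (intro continuous_intros contf)
  have ab2: "a\<^sup>2 \<le> b\<^sup>2" using ab a0 by (intro power_mono) auto
  \<comment> \<open>To the right of \<open>z\<close>, \<open>X\<close> grows at least as much as
    \<open>Y\<close>, so increments of \<open>S\<close> are at most those of \<open>2 X + Z\<close>;
    to the left they are at most those of \<open>2 Y + Z\<close>.\<close>
  obtain z where z: "z \<in> {a\<^sup>2..b\<^sup>2}"
    and zr: "\<And>v w. z \<le> v \<Longrightarrow> v \<le> w \<Longrightarrow> w \<le> b\<^sup>2 \<Longrightarrow> X v - Y v \<le> X w - Y w"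
    and zl: "\<And>v w. a\<^sup>2 \<le> v \<Longrightarrow> v \<le> w \<Longrightarrow> w \<le> z \<Longrightarrow> X w - Y w \<le> X v - Y v"
    by (rule convex_on_min_split[OF convD contD ab2]) blast
  define x where "x = sqrt z"
  have "a\<^sup>2 \<le> z" using z by simp
  then have z0: "0 \<le> z" using a2 by linarith
  have x: "a \<le> x" "x \<le> b" "x\<^sup>2 = z"
    using z z0 a0 ab by (auto simp: x_def intro: real_le_rsqrt real_le_lsqrt)

  have right: "(w - v) * (S t - S s) \<le> 1200 * ((t - s) * (S w - S v))"
    if "z \<le> s" "s \<le> t" "t \<le> v" "v \<le> w" "w \<le> b\<^sup>2" for s t v w
  proof -
    have i: "a\<^sup>2 \<le> s" "t \<le> b\<^sup>2" "a\<^sup>2 \<le> v" using z that by auto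
    have "S t - S s \<le> 2 * (X t - X s) + (Z t - Z s)"
      using zr[OF that(1,2) i(2)] unfolding SXYZ by (simp add: algebra_simps)
    then have "(w - v) * (S t - S s) \<le> (w - v) * (2 * (X t - X s) + (Z t - Z s))"
      using that by (intro mult_left_mono) auto
    also have "\<dots> = 2 * ((X t - X s) * (w - v)) + (w - v) * (Z t - Z s)" by (simp add: algebra_simps)
    also have "\<dots> \<le> 2 * ((X w - X v) * (t - s)) + 1200 * ((t - s) * (Z w - Z v))"
      using that i by (intro add_mono mult_left_mono convex_on_slopes[OF convX] Zcomp) auto
    also have "\<dots> = (t - s) * (2 * (X w - X v) + 1200 * (Z w - Z v))" by (simp add: algebra_simps)
    also have "\<dots> \<le> (t - s) * (1200 * (S w - S v))"
      using that monoXYZ[of v w] unfolding SXYZ by (intro mult_left_mono) auto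
    also have "\<dots> = 1200 * ((t - s) * (S w - S v))" by (rule mult.left_commute)
    finally show ?thesis .
  qed
  have left: "(w - v) * (S t - S s) \<le> 1200 * ((t - s) * (S w - S v))"
    if "a\<^sup>2 \<le> v" "v \<le> w" "w \<le> s" "s \<le> t" "t \<le> z" for s t v w
  proof -
    have i: "a\<^sup>2 \<le> s" "t \<le> b\<^sup>2" "w \<le> b\<^sup>2" using z that by auto
    have "S t - S s \<le> 2 * (Y t - Y s) + (Z t - Z s)"
      using zl[OF i(1) that(4,5)] unfolding SXYZ by (simp add: algebra_simps)
    then have "(w - v) * (S t - S s) \<le> (w - v) * (2 * (Y t - Y s) + (Z t - Z s))"
      using that by (intro mult_left_mono) auto
    also have "\<dots> = 2 * ((Y t - Y s) * (w - v)) + (w - v) * (Z t - Z s)" by (simp add: algebra_simps)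
    also have "\<dots> \<le> 2 * ((Y w - Y v) * (t - s)) + 1200 * ((t - s) * (Z w - Z v))"
      using that i by (intro add_mono mult_left_mono concave_on_slopes[OF concY] Zcomp) auto
    also have "\<dots> = (t - s) * (2 * (Y w - Y v) + 1200 * (Z w - Z v))" by (simp add: algebra_simps)
    also have "\<dots> \<le> (t - s) * (1200 * (S w - S v))"
      using that monoXYZ[of v w] unfolding SXYZ by (intro mult_left_mono) auto
    also have "\<dots> = 1200 * ((t - s) * (S w - S v))" by (rule mult.left_commute)
    finally show ?thesis .
  qed
  \<comment> \<open>Back from squared radii to radii: \<open>w^2 - v^2 = (v + w) (w - v)\<close>,
    with sums of radii between \<open>2 a\<close> and \<open>16/7 a\<close> because
    \<open>R / 4 <= a / 7\<close>. Then \<open>1200 * 8/7 < 1372\<close>.\<close>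
  have radial: "(w - v) * (P t - P s) \<le> 1372 * (t - s) * (P w - P v)"
    if "(w\<^sup>2 - v\<^sup>2) * (S (t\<^sup>2) - S (s\<^sup>2)) \<le> 1200 * ((t\<^sup>2 - s\<^sup>2) * (S (w\<^sup>2) - S (v\<^sup>2)))"
      "a \<le> v" "v \<le> w" "a \<le> s" "s \<le> t" "t \<le> b" for s t v w
  proof -
    have PP: "P t - P s = 2 * A * (S (t\<^sup>2) - S (s\<^sup>2))" for t s by (simp add: PS algebra_simps)
    have Pm: "0 \<le> P t - P s" "0 \<le> P w - P v" using monoP that by auto
    have "2 * a * ((w - v) * (P t - P s)) = (2 * a) * (w - v) * (P t - P s)" by simp
    also have "\<dots> \<le> (v + w) * (w - v) * (P t - P s)"
      using that Pm by (intro mult_right_mono) auto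
    also have "\<dots> = 2 * A * ((w\<^sup>2 - v\<^sup>2) * (S (t\<^sup>2) - S (s\<^sup>2)))" by (simp add: PP power2_eq_square algebra_simps)
    also have "\<dots> \<le> 2 * A * (1200 * ((t\<^sup>2 - s\<^sup>2) * (S (w\<^sup>2) - S (v\<^sup>2))))"
      using that(1) A by (intro mult_left_mono) auto
    also have "\<dots> = 1200 * ((s + t) * ((t - s) * (P w - P v)))" by (simp add: PP power2_eq_square algebra_simps)
    also have "\<dots> \<le> 1200 * ((2 * (8/7 * a)) * ((t - s) * (P w - P v)))"
      using that Pm a by (intro mult_left_mono mult_right_mono mult_nonneg_nonneg) (auto simp: b_def)
    also have "\<dots> \<le> 2 * a * (1372 * (t - s) * (P w - P v))"
    proof -
      define q where "q = a * ((t - s) * (P w - P v))"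
      have "0 \<le> q" using that Pm a0 by (simp add: q_def)
      moreover have "2 * a * (1372 * (t - s) * (P w - P v)) = 2744 * q" unfolding q_def by algebra
      moreover have "1200 * ((2 * (8/7 * a)) * ((t - s) * (P w - P v))) = 19200/7 * q" by (simp add: q_def)
      ultimately show ?thesis by linarith
    qed
    finally show ?thesis by (rule mult_left_le_imp_le) (use a0 in simp)
  qed

  let ?G = "\<lambda>u w. {v \<in> {u..w}. \<forall>k::int. c \<le> \<bar>P v - 2 * of_int k\<bar>}"
  \<comment> \<open>One side of \<open>x\<close> has length at least \<open>R / 8\<close>; taking
    off the \<open>R / 16\<close> for the passage without a gap leaves
    \<open>R / 16\<close>.\<close>
  have key: "\<exists>u w. a \<le> u \<and> w \<le> b \<and> R / 16 \<le> (1 + 1372 * c / (1 - c)) * measure lborel (?G u w)"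
  proof (cases "x \<le> a + R / 8")
    case True
    have "b - x \<le> R / 16 + (1 + 1372 * c / (1 - c)) * measure lborel (?G x b)"
    proof (rule measure_away_from_even_ge)
      show "continuous_on {x..b} P" by (rule continuous_on_subset[OF contP]) (use x in auto)
      show "(w - v) * (P t - P s) \<le> 1372 * (t - s) * (P w - P v)"
        if "x \<le> s" "s \<le> t" "t \<le> v" "v \<le> w" "w \<le> b" for s t v w
      proof (rule radial)
        show "(w\<^sup>2 - v\<^sup>2) * (S (t\<^sup>2) - S (s\<^sup>2)) \<le> 1200 * ((t\<^sup>2 - s\<^sup>2) * (S (w\<^sup>2) - S (v\<^sup>2)))"
          using that x(1,2) a0 by (intro right) (auto intro!: power_mono simp: x(3)[symmetric])
      qed (use that x(1,2) in auto)
    qed (use x(1,2) c monoP short R in auto)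
    then show ?thesis using True x(1,2) R by (intro exI[of _ x] exI[of _ b]) (auto simp: b_def)
  next
    case False
    have "x - a \<le> R / 16 + (1 + 1372 * c / (1 - c)) * measure lborel (?G a x)"
    proof (rule measure_away_from_even_ge_left)
      show "continuous_on {a..x} P" by (rule continuous_on_subset[OF contP]) (use x in auto)
      show "(w - v) * (P t - P s) \<le> 1372 * (t - s) * (P w - P v)"
        if "a \<le> v" "v \<le> w" "w \<le> s" "s \<le> t" "t \<le> x" for s t v w
      proof (rule radial)
        show "(w\<^sup>2 - v\<^sup>2) * (S (t\<^sup>2) - S (s\<^sup>2)) \<le> 1200 * ((t\<^sup>2 - s\<^sup>2) * (S (w\<^sup>2) - S (v\<^sup>2)))"
          using that x(1,2) a0 by (intro left) (auto intro!: power_mono simp: x(3)[symmetric])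
      qed (use that x(1,2) in auto)
    qed (use x(1,2) c monoP short R in auto)
    then show ?thesis using False x(1,2) R by (intro exI[of _ a] exI[of _ x]) (auto simp: b_def)
  qed
  then obtain u w where uw: "a \<le> u" "w \<le> b" "R / 16 \<le> (1 + 1372 * c / (1 - c)) * measure lborel (?G u w)" by blast
  have sets: "?G u w \<in> sets borel" if "a \<le> u" "w \<le> b" for u w
  proof -
    have "?G u w = (\<Inter>k::int. {v \<in> {u..w}. P v \<in> {p. c \<le> \<bar>p - 2 * of_int k\<bar>}})" by auto
    also have "\<dots> \<in> sets borel"
      by (intro sets.countable_INT'' borel_preimage_Icc continuous_on_subset[OF contP]) (use that in auto)
    finally show ?thesis .
  qed
  have "R / 16 \<le> (1 + 1372 * c / (1 - c)) * measure lborel (?G u w)" by (rule uw(3))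
  also have "\<dots> \<le> 12 * measure lborel (?G a b)"
  proof (rule mult_mono)
    \<comment> \<open>\<open>c <= 1/130\<close> gives at most \<open>1 + 1372/129 < 12\<close>, and
      \<open>R / 16\<close> divided by 12 is \<open>R / 192\<close>.\<close>
    show "1 + 1372 * c / (1 - c) \<le> 12" using c by (simp add: field_simps)
    show "measure lborel (?G u w) \<le> measure lborel (?G a b)"
    proof (rule measure_mono_fmeasurable)
      show "?G u w \<subseteq> ?G a b" using uw(1,2) by auto
      show "?G u w \<in> sets lborel" using sets[OF uw(1,2)] by simp
      show "?G a b \<in> fmeasurable lborel"
        by (rule fmeasurable_subset_Icc[of _ a b, OF sets[OF order_refl order_refl]]) blast
    qed
  qed simp_all
  finally have "R / 16 \<le> 12 * measure lborel (?G a b)" .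
  then show ?thesis unfolding b_def c_def by simp
qed

section \<open>Poincare inequality on windows\<close>

text \<open>The Cauchy-Schwarz inequality, obtained by integrating
  \<open>|u'| <= (t^2 + |u'|^2) / (2 t)\<close> and choosing \<open>t\<close> at the end.\<close>

lemma norm_increment_le:
  fixes u u' :: "real \<Rightarrow> complex"
  assumes ab: "a \<le> b" and u: "(u' has_integral (u b - u a)) {a..b}"
    and int: "(\<lambda>r. (cmod (u' r))\<^sup>2) integrable_on {a..b}"
  shows "(cmod (u b - u a))\<^sup>2 \<le> (b - a) * integral {a..b} (\<lambda>r. (cmod (u' r))\<^sup>2)"
proof -
  define E where "E = integral {a..b} (\<lambda>r. (cmod (u' r))\<^sup>2)"
  define n where "n = cmod (u b - u a)"
  have key: "2 * t * n \<le> t\<^sup>2 * (b - a) + E" if t: "0 < t" for t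
  proof -
    have g: "((\<lambda>r. (t\<^sup>2 + (cmod (u' r))\<^sup>2) / (2 * t)) has_integral (t\<^sup>2 * (b - a) + E) / (2 * t)) {a..b}"
      unfolding E_def using ab has_integral_const_real[of "t\<^sup>2" a b]
      by (intro has_integral_divide has_integral_add integrable_integral int) (simp add: mult.commute)
    have "norm (integral {a..b} u') \<le> integral {a..b} (\<lambda>r. (t\<^sup>2 + (cmod (u' r))\<^sup>2) / (2 * t))"
    proof (rule integral_norm_bound_integral)
      fix r
      have "0 \<le> (t - cmod (u' r))\<^sup>2" by simp
      then show "norm (u' r) \<le> (t\<^sup>2 + (cmod (u' r))\<^sup>2) / (2 * t)"
        using t by (simp add: pos_le_divide_eq power2_diff mult_ac)
    qed (use u g in auto)
    then have "n \<le> (t\<^sup>2 * (b - a) + E) / (2 * t)"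
      unfolding integral_unique[OF g] integral_unique[OF u] n_def .
    then show ?thesis using t by (simp add: pos_le_divide_eq mult_ac)
  qed
  show ?thesis
  proof (cases "n = 0 \<or> a = b")
    case True
    have "0 \<le> E" unfolding E_def by (rule integral_nonneg[OF int]) simp
    then show ?thesis using True ab unfolding n_def E_def by auto
  next
    case False
    then have pos: "0 < n" "0 < b - a" using ab by (auto simp: n_def)
    \<comment> \<open>This value maximises \<open>2 t n - t^2 (b - a)\<close>.\<close>
    define t where "t = n / (b - a)"
    have t: "0 < t" "t * (b - a) = n" using pos by (auto simp: t_def)
    from key[OF t(1)] have "2 * t * n \<le> t * n + E" using t(2) by (simp add: power2_eq_square mult.assoc)
    then have "t * n \<le> E" by (simp add: mult.commute)
    then have "(b - a) * (t * n) \<le> (b - a) * E" using pos by simp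
    moreover have "(b - a) * (t * n) = n\<^sup>2" using t(2) by (simp add: power2_eq_square mult_ac)
    ultimately show ?thesis by (simp add: n_def E_def)
  qed
qed

lemma set_integrable_mult_bounded:
  fixes f h :: "real \<Rightarrow> real"
  assumes f: "set_integrable lborel S f" and S: "S \<in> sets borel"
    and h: "h \<in> borel_measurable borel" and b: "\<And>r. r \<in> S \<Longrightarrow> \<bar>h r\<bar> \<le> C"
  shows "set_integrable lborel S (\<lambda>r. f r * h r)"
  unfolding set_integrable_def
proof (rule Bochner_Integration.integrable_bound)
  show "integrable lborel (\<lambda>r. C * (indicator S r *\<^sub>R f r))"
    using f unfolding set_integrable_def by simp
  have "(\<lambda>r. (indicator S r *\<^sub>R f r) * h r) \<in> borel_measurable lborel"
    using borel_measurable_integrable[OF f[unfolded set_integrable_def]] h by simp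
  then show "(\<lambda>r. indicator S r *\<^sub>R (f r * h r)) \<in> borel_measurable lborel" by (simp add: mult.assoc)
  show "AE r in lborel. norm (indicator S r *\<^sub>R (f r * h r)) \<le> norm (C * (indicator S r *\<^sub>R f r))"
  proof (rule AE_I2)
    fix r
    show "norm (indicator S r *\<^sub>R (f r * h r)) \<le> norm (C * (indicator S r *\<^sub>R f r))"
    proof (cases "r \<in> S")
      case True
      have "\<bar>f r\<bar> * \<bar>h r\<bar> \<le> \<bar>f r\<bar> * \<bar>C\<bar>" using b[OF True] by (intro mult_left_mono) auto
      then show ?thesis using True by (simp add: abs_mult mult.commute)
    qed simp
  qed
qed

lemma set_integral_nonneg:
  fixes f :: "'a \<Rightarrow> real"
  assumes "\<And>x. x \<in> S \<Longrightarrow> 0 \<le> f x"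
  shows "0 \<le> (LINT x:S|M. f x)"
  unfolding set_lebesgue_integral_def
  by (rule Bochner_Integration.integral_nonneg) (simp add: assms indicator_def)

lemma set_integral_mono_subset:
  fixes f :: "'a \<Rightarrow> real"
  assumes "set_integrable M T f" "S \<in> sets M" "S \<subseteq> T" "\<And>x. x \<in> T \<Longrightarrow> 0 \<le> f x"
  shows "(LINT x:S|M. f x) \<le> (LINT x:T|M. f x)"
  unfolding set_lebesgue_integral_def
proof (rule integral_mono)
  show "integrable M (\<lambda>x. indicator S x *\<^sub>R f x)" "integrable M (\<lambda>x. indicator T x *\<^sub>R f x)"
    using set_integrable_subset[OF assms(1-3)] assms(1) by (auto simp: set_integrable_def)
  show "indicator S x *\<^sub>R f x \<le> indicator T x *\<^sub>R f x" for x
    using assms(3,4) by (auto simp: indicator_def)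
qed

text \<open>A Poincare inequality with control on \<open>G\<close> only:
  \<open>|u x|^2 <= 2 |u y|^2 + 2 (B - A) E\<close> is averaged over \<open>y\<close> in
  \<open>G\<close> and then integrated over \<open>x\<close>. The window is open at \<open>A\<close>
  because the fundamental theorem of calculus is assumed only to the right of
  \<open>A\<close>.\<close>

lemma window_bound:
  fixes u u' :: "real \<Rightarrow> complex"
  assumes AB: "0 < A" "A \<le> B"
    and ftc: "\<And>a b. A < a \<Longrightarrow> a \<le> b \<Longrightarrow> b \<le> B \<Longrightarrow> (u' has_integral (u b - u a)) {a..b}"
    and intu: "set_integrable lborel {A<..B} (\<lambda>r. (cmod (u r))\<^sup>2 / r)"
    and intu': "set_integrable lborel {A<..B} (\<lambda>r. (cmod (u' r))\<^sup>2 * r)"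
    and G: "G \<in> sets borel" "G \<subseteq> {A<..B}" and g: "0 < g" "g \<le> measure lborel G"
  shows "(LINT r:{A<..B}|lborel. (cmod (u r))\<^sup>2 / r) \<le>
    2 * (B - A) * B / (A * g) * (LINT r:G|lborel. (cmod (u r))\<^sup>2 / r)
    + 2 * ((B - A) / A)\<^sup>2 * (LINT r:{A<..B}|lborel. (cmod (u' r))\<^sup>2 * r)"
proof -
  let ?W = "{A<..B}"
  define l where "l = B - A"
  define E where "E = (LINT r:?W|lborel. (cmod (u' r))\<^sup>2)"
  define V where "V = (LINT r:G|lborel. (cmod (u r))\<^sup>2)"
  define VG where "VG = (LINT r:G|lborel. (cmod (u r))\<^sup>2 / r)"
  define E1 where "E1 = (LINT r:?W|lborel. (cmod (u' r))\<^sup>2 * r)"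
  have l0: "0 \<le> l" using AB by (simp add: l_def)
  have inte: "set_integrable lborel ?W (\<lambda>r. (cmod (u' r))\<^sup>2)"
  proof -
    have "set_integrable lborel ?W (\<lambda>r. ((cmod (u' r))\<^sup>2 * r) * (1 / r))"
      using AB by (intro set_integrable_mult_bounded[OF intu', where C = "1 / A"]) (auto simp: frac_le)
    then show ?thesis
      by (rule set_integrable_cong[THEN iffD1, rotated -1]) (use AB in auto)
  qed
  have intw: "set_integrable lborel ?W (\<lambda>r. (cmod (u r))\<^sup>2)"
  proof -
    have "set_integrable lborel ?W (\<lambda>r. ((cmod (u r))\<^sup>2 / r) * r)"
      using AB by (intro set_integrable_mult_bounded[OF intu, where C = B]) auto
    then show ?thesis
      by (rule set_integrable_cong[THEN iffD1, rotated -1]) (use AB in auto)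
  qed
  have intG: "set_integrable lborel G (\<lambda>r. (cmod (u r))\<^sup>2)" "set_integrable lborel G (\<lambda>r. (cmod (u r))\<^sup>2 / r)"
    using set_integrable_subset[OF intw _ G(2)] set_integrable_subset[OF intu _ G(2)] G(1) by auto
  have Gf: "G \<in> fmeasurable lborel"
    by (rule fmeasurable_subset_Icc[OF G(1), of A B]) (use G(2) in auto)
  have intc: "set_integrable lborel S (\<lambda>r. k)" if "S \<in> fmeasurable lborel" for S and k :: real
    using that unfolding set_integrable_def by (simp add: fmeasurable_def)
  have Wf: "?W \<in> fmeasurable lborel" by (rule fmeasurable_subset_Icc[of _ A B]) auto
  have E0: "0 \<le> E" unfolding E_def by (rule set_integral_nonneg) auto

  have inc: "(cmod (u b - u a))\<^sup>2 \<le> l * E" if "A < a" "a \<le> b" "b \<le> B" for a b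
  proof -
    have si: "set_integrable lborel {a..b} (\<lambda>r. (cmod (u' r))\<^sup>2)"
      by (rule set_integrable_subset[OF inte]) (use that in auto)
    have "integral {a..b} (\<lambda>r. (cmod (u' r))\<^sup>2) = (LINT r:{a..b}|lborel. (cmod (u' r))\<^sup>2)"
      by (rule set_borel_integral_eq_integral(2)[OF si, symmetric])
    also have "\<dots> \<le> E" unfolding E_def
      by (rule set_integral_mono_subset[OF inte]) (use that in \<open>auto\<close>)
    finally have le: "integral {a..b} (\<lambda>r. (cmod (u' r))\<^sup>2) \<le> E" .
    have "(cmod (u b - u a))\<^sup>2 \<le> (b - a) * integral {a..b} (\<lambda>r. (cmod (u' r))\<^sup>2)"
      by (rule norm_increment_le[OF that(2) ftc[OF that] set_borel_integral_eq_integral(1)[OF si]])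
    also have "\<dots> \<le> l * E"
      using that le E0 l0 by (intro mult_mono integral_nonneg set_borel_integral_eq_integral(1)[OF si]) (auto simp: l_def)
    finally show ?thesis .
  qed
  have pt: "(cmod (u x))\<^sup>2 \<le> 2 * (cmod (u y))\<^sup>2 + 2 * (l * E)" if "x \<in> ?W" "y \<in> ?W" for x y
  proof -
    have "(cmod (u x - u y))\<^sup>2 \<le> l * E"
      using inc[of y x] inc[of x y] that by (cases "x \<le> y") (auto simp: norm_minus_commute)
    moreover have "cmod (u x) \<le> cmod (u y) + cmod (u x - u y)"
      using norm_triangle_ineq[of "u y" "u x - u y"] by simp
    then have "(cmod (u x))\<^sup>2 \<le> (cmod (u y) + cmod (u x - u y))\<^sup>2" by (intro power_mono) auto
    moreover have "(cmod (u y) + cmod (u x - u y))\<^sup>2 \<le> 2 * (cmod (u y))\<^sup>2 + 2 * (cmod (u x - u y))\<^sup>2"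
      using zero_le_power2[of "cmod (u y) - cmod (u x - u y)"] by (simp add: power2_sum power2_diff)
    ultimately show ?thesis by linarith
  qed
  \<comment> \<open>The weights are traded for their extreme values on the window:
    \<open>r <= B\<close> here, \<open>r >= A\<close> for the energy.\<close>
  have VB: "V \<le> B * VG"
  proof -
    have "V \<le> (LINT r:G|lborel. B * ((cmod (u r))\<^sup>2 / r))"
      unfolding V_def
    proof (rule set_integral_mono[OF intG(1)])
      show "set_integrable lborel G (\<lambda>r. B * ((cmod (u r))\<^sup>2 / r))" by (rule set_integrable_mult_right) (rule intG(2))
      fix r assume "r \<in> G"
      then have "0 < r" "r \<le> B" using G(2) AB by auto
      then have "r * ((cmod (u r))\<^sup>2 / r) \<le> B * ((cmod (u r))\<^sup>2 / r)" by (intro mult_right_mono) auto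
      then show "(cmod (u r))\<^sup>2 \<le> B * ((cmod (u r))\<^sup>2 / r)" using \<open>0 < r\<close> by simp
    qed
    then show ?thesis by (simp only: set_integral_mult_right VG_def)
  qed
  have EE: "A * E \<le> E1"
  proof -
    have "(LINT r:?W|lborel. A * (cmod (u' r))\<^sup>2) \<le> E1"
      unfolding E1_def
    proof (rule set_integral_mono[OF _ intu'])
      show "set_integrable lborel ?W (\<lambda>r. A * (cmod (u' r))\<^sup>2)" using inte by simp
      fix r assume "r \<in> ?W"
      then show "A * (cmod (u' r))\<^sup>2 \<le> (cmod (u' r))\<^sup>2 * r" by (simp add: mult.commute[of _ r] mult_right_mono)
    qed
    then show ?thesis by (simp only: set_integral_mult_right E_def)
  qed
  have VG0: "0 \<le> VG" "0 \<le> V" unfolding VG_def V_def using G AB by (auto intro!: set_integral_nonneg)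
  define K where "K = 2 * V / g + 2 * (l * E)"
  have ptK: "(cmod (u x))\<^sup>2 \<le> K" if x: "x \<in> ?W" for x
  proof -
    define m where "m = measure lborel G"
    have m: "0 < m" "g \<le> m" using g by (auto simp: m_def)
    have "(LINT y:G|lborel. (cmod (u x))\<^sup>2) \<le> (LINT y:G|lborel. 2 * (cmod (u y))\<^sup>2 + 2 * (l * E))"
    proof (rule set_integral_mono[OF intc[OF Gf]])
      show "set_integrable lborel G (\<lambda>y. 2 * (cmod (u y))\<^sup>2 + 2 * (l * E))"
        using intG(1) intc[OF Gf] by (intro set_integral_add) auto
    qed (use pt[OF x] G(2) in auto)
    also have "\<dots> = (LINT y:G|lborel. 2 * (cmod (u y))\<^sup>2) + (LINT y:G|lborel. 2 * (l * E))"
      using intG(1) intc[OF Gf] by (intro set_integral_add) auto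
    also have "(LINT y:G|lborel. 2 * (cmod (u y))\<^sup>2) = 2 * V" by (simp add: V_def)
    also have "(LINT y:G|lborel. 2 * (l * E)) = m * (2 * (l * E))"
      using Gf by (simp add: m_def set_lebesgue_integral_def fmeasurable_def)
    also have "(LINT y:G|lborel. (cmod (u x))\<^sup>2) = m * (cmod (u x))\<^sup>2"
      using Gf by (simp add: m_def set_lebesgue_integral_def fmeasurable_def)
    \<comment> \<open>Division by the measure \<open>m\<close> of \<open>G\<close> completes the
      average.\<close>
    finally have "(cmod (u x))\<^sup>2 \<le> 2 * V / m + 2 * (l * E)"
      using m by (simp add: field_simps)
    moreover have "2 * V / m \<le> 2 * V / g" using m g VG0 by (intro divide_left_mono) auto
    ultimately show ?thesis by (simp add: K_def)
  qed
  have K0: "0 \<le> K" using VG0 g l0 E0 by (simp add: K_def)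
  have "(LINT r:?W|lborel. (cmod (u r))\<^sup>2 / r) \<le> (LINT r:?W|lborel. K / A)"
  proof (rule set_integral_mono[OF intu intc[OF Wf]])
    fix r assume "r \<in> ?W"
    then show "(cmod (u r))\<^sup>2 / r \<le> K / A" using ptK[of r] AB K0 by (intro frac_le) auto
  qed
  also have "\<dots> = l * (K / A)"
    using AB by (simp add: set_lebesgue_integral_def l_def)
  also have "\<dots> = 2 * l / (A * g) * V + 2 * l * (l / A\<^sup>2) * (A * E)"
    using AB g by (simp add: K_def field_simps power2_eq_square)
  also have "\<dots> \<le> 2 * l / (A * g) * (B * VG) + 2 * l * (l / A\<^sup>2) * E1"
    using VB EE AB g l0 by (intro add_mono mult_left_mono) auto
  finally show ?thesis by (simp add: l_def VG_def E1_def power2_eq_square mult_ac)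
qed

lemma weighted_W12_integrable_div:
  assumes R: "0 < R" and u: "weighted_W12 R L u u'"
  shows "set_integrable lborel {R..L} (\<lambda>r. (cmod (u r))\<^sup>2 / r)"
proof -
  have iu: "set_integrable lborel {R..L} (\<lambda>r. (cmod (u r))\<^sup>2 * r)"
    using u unfolding weighted_W12_def by blast
  have "set_integrable lborel {R..L} (\<lambda>r. ((cmod (u r))\<^sup>2 * r) * (1 / r\<^sup>2))"
    using R by (intro set_integrable_mult_bounded[OF iu, where C = "1 / R\<^sup>2"]) (auto intro!: divide_left_mono power_mono)
  then show ?thesis
    by (rule set_integrable_cong[THEN iffD1, rotated -1]) (use R in \<open>auto simp: power2_eq_square\<close>)
qed

text \<open>Induction over \<open>n\<close> consecutive windows of length \<open>l\<close>. The
  window starting at \<open>a\<close> contains the stretch \<open>[a + 3/4 R, a + R]\<close>, where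
  \<open>dens\<close> supplies the part of \<open>G\<close> that it requires.\<close>

lemma windows_bound:
  fixes u u' :: "real \<Rightarrow> complex"
  assumes R: "0 < R" and l: "R \<le> l" "l \<le> 6/5 * R" and L: "L = R + real n * l"
    and u: "weighted_W12 R L u u'"
    and G: "G \<in> sets borel"
    and dens: "\<And>a. R \<le> a \<Longrightarrow> R / 192 \<le> measure lborel (G \<inter> {a + 3/4 * R..a + R})"
  shows "(LINT r:{R<..L}|lborel. (cmod (u r))\<^sup>2 / r) \<le>
    1014 * (LINT r:{R<..L}|lborel. indicator G r * ((cmod (u r))\<^sup>2 / r))
    + 3 * (LINT r:{R<..L}|lborel. (cmod (u' r))\<^sup>2 * r)"
proof -
  let ?w = "\<lambda>r. (cmod (u r))\<^sup>2 / r" and ?e = "\<lambda>r. (cmod (u' r))\<^sup>2 * r"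
  let ?g = "\<lambda>r. indicator G r * ((cmod (u r))\<^sup>2 / r)"
  have ftc: "(u' has_integral (u b - u a)) {a..b}" if "R < a" "a \<le> b" "b \<le> L" for a b
    using u that unfolding weighted_W12_def by blast
  have ie: "set_integrable lborel {R..L} ?e" using u unfolding weighted_W12_def by blast
  have iw: "set_integrable lborel {R..L} ?w" by (rule weighted_W12_integrable_div[OF R u])
  have ig: "set_integrable lborel {R..L} ?g"
  proof -
    have "set_integrable lborel {R..L} (\<lambda>r. ?w r * indicator G r)"
      using G by (intro set_integrable_mult_bounded[OF iw, where C = 1]) (auto simp: indicator_def)
    then show ?thesis by (simp only: mult.commute)
  qed
  have l0: "0 < l" using l R by linarith
  define T where "T = (\<lambda>m::nat. R + real m * l)"
  have TS: "T (Suc m) = T m + l" for m by (simp add: T_def algebra_simps)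
  have T0: "R \<le> T m" for m using l0 by (simp add: T_def)
  have "(LINT r:{R<..T m}|lborel. ?w r) \<le> 1014 * (LINT r:{R<..T m}|lborel. ?g r) + 3 * (LINT r:{R<..T m}|lborel. ?e r)"
    if "m \<le> n" for m
    using that
  proof (induction m)
    case 0
    then show ?case by (simp add: T_def set_lebesgue_integral_def)
  next
    case (Suc m)
    define A where "A = T m"
    define B where "B = T (Suc m)"
    have AB: "R \<le> A" "B = A + l" "A < B" using T0 l0 by (auto simp: A_def B_def TS)
    have BL: "B \<le> L" using Suc.prems l0 by (simp add: B_def T_def L mult_right_mono del: of_nat_Suc)
    have A0: "0 < A" using AB R by simp
    have sub: "{A<..B} \<subseteq> {R..L}" "{R<..A} \<subseteq> {R..L}" using AB BL by auto
    define H where "H = G \<inter> {A + 3/4 * R..A + R}"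
    have H: "H \<in> sets borel" "H \<subseteq> {A<..B}" "H \<subseteq> G" using G AB l R by (auto simp: H_def)
    have win: "(LINT r:{A<..B}|lborel. ?w r) \<le>
      2 * (B - A) * B / (A * (R / 192)) * (LINT r:H|lborel. ?w r)
      + 2 * ((B - A) / A)\<^sup>2 * (LINT r:{A<..B}|lborel. ?e r)"
    proof (rule window_bound)
      show "(u' has_integral (u b - u a)) {a..b}" if "A < a" "a \<le> b" "b \<le> B" for a b
        using that AB BL by (intro ftc) auto
      show "set_integrable lborel {A<..B} ?w" "set_integrable lborel {A<..B} ?e"
        using set_integrable_subset[OF iw _ sub(1)] set_integrable_subset[OF ie _ sub(1)] by auto
      show "R / 192 \<le> measure lborel H" unfolding H_def by (rule dens[OF AB(1)])
    qed (use A0 AB H R in auto)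
    have "(LINT r:H|lborel. ?w r) = (LINT r:H|lborel. ?g r)"
      using H by (intro set_lebesgue_integral_cong) auto
    also have "\<dots> \<le> (LINT r:{A<..B}|lborel. ?g r)"
      using H(1,2) A0 by (intro set_integral_mono_subset set_integrable_subset[OF ig _ sub(1)]) auto
    finally have wg: "(LINT r:H|lborel. ?w r) \<le> (LINT r:{A<..B}|lborel. ?g r)" .
    \<comment> \<open>With \<open>l <= 6/5 R\<close> and \<open>B <= 11/5 A\<close> the constant is
      \<open>2 * 6/5 * 11/5 * 192 = 1013.76\<close>.\<close>
    have c1: "2 * (B - A) * B / (A * (R / 192)) \<le> 1014"
    proof -
      have "2 * (B - A) * B * 192 \<le> 2 * (6/5 * R) * (11/5 * A) * 192"
        using AB l R A0 by (intro mult_right_mono mult_mono) auto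
      also have "\<dots> \<le> 1014 * (A * R)" using mult_pos_pos[OF A0 R] by simp
      finally show ?thesis using A0 R by (simp add: field_simps)
    qed
    \<comment> \<open>\<open>2 * (6/5)^2 = 2.88\<close>.\<close>
    have c2: "2 * ((B - A) / A)\<^sup>2 \<le> 3"
    proof -
      have "(B - A) / A \<le> 6/5" using AB l R by (simp add: field_simps)
      moreover have "0 \<le> (B - A) / A" using AB A0 by simp
      ultimately have "((B - A) / A)\<^sup>2 \<le> (6/5)\<^sup>2" by (intro power_mono)
      then show ?thesis by (simp add: power2_eq_square)
    qed
    have g0: "0 \<le> (LINT r:{A<..B}|lborel. ?g r)" "0 \<le> (LINT r:{A<..B}|lborel. ?e r)" "0 \<le> (LINT r:H|lborel. ?w r)"
      using A0 H(2) by (auto intro!: set_integral_nonneg)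
    have "(LINT r:{A<..B}|lborel. ?w r) \<le> 1014 * (LINT r:{A<..B}|lborel. ?g r) + 3 * (LINT r:{A<..B}|lborel. ?e r)"
      by (rule order_trans[OF win]) (intro add_mono mult_mono c1 c2 wg g0 order_refl; simp)
    moreover have "(LINT r:{R<..A}|lborel. ?w r) \<le> 1014 * (LINT r:{R<..A}|lborel. ?g r) + 3 * (LINT r:{R<..A}|lborel. ?e r)"
      using Suc by (simp add: A_def)
    moreover have split: "(LINT r:{R<..B}|lborel. f r) = (LINT r:{R<..A}|lborel. f r) + (LINT r:{A<..B}|lborel. f r)"
      if "set_integrable lborel {R..L} f" for f :: "real \<Rightarrow> real"
    proof -
      have "{R<..B} = {R<..A} \<union> {A<..B}" using AB by auto
      moreover have "(LINT r:{R<..A} \<union> {A<..B}|lborel. f r) = (LINT r:{R<..A}|lborel. f r) + (LINT r:{A<..B}|lborel. f r)"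
        by (intro set_integral_Un set_integrable_subset[OF that _ sub(1)] set_integrable_subset[OF that _ sub(2)]) auto
      ultimately show ?thesis by simp
    qed
    ultimately show ?case unfolding B_def[symmetric] split[OF iw] split[OF ig] split[OF ie] by (simp add: algebra_simps)
  qed
  from this[OF order_refl] show ?thesis by (simp add: T_def L)
qed

section \<open>The flux and its distance from the even integers\<close>

lemma Phi_hat_eq_disk_share:
  assumes R: "0 < R" and r: "R \<le> r"
  shows "Phi_hat \<alpha> N y R r = \<alpha> * (1 + 2 * (\<Sum>l = 1..N-2. disk_share (y l) R (r\<^sup>2)))"
proof -
  have eq: "(LINT x:ball 0 r|lborel. indicator (ball z s) x / (pi * s\<^sup>2)) = disk_share z s (r\<^sup>2)" for z :: "real^2" and s
  proof -
    have "(LINT x:ball 0 r|lborel. indicator (ball z s) x / (pi * s\<^sup>2))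
      = (LINT x|lborel. indicator (ball 0 r \<inter> ball z s) x / (pi * s\<^sup>2))"
      unfolding set_lebesgue_integral_def
      by (rule Bochner_Integration.integral_cong) (auto simp: indicator_def)
    also have "\<dots> = measure lborel (ball 0 r \<inter> ball z s) / (pi * s\<^sup>2)" by simp
    finally show ?thesis using R r by (simp add: disk_share_def)
  qed
  \<comment> \<open>From radius \<open>R\<close> on, the central disk is completely covered; this is
    the summand 1.\<close>
  have "disk_share 0 (R/2) (r\<^sup>2) = 1" using R r by (intro disk_share_eq_1) (auto intro!: power_mono)
  then show ?thesis using R by (simp only: Phi_hat_def eq if_True)
qed

lemma rho_ge:
  assumes "0 \<le> c" "\<And>q::int. c \<le> \<bar>Phi_hat \<alpha> N y R r - 2 * of_int q\<bar>"
  shows "c\<^sup>2 \<le> rho \<alpha> N y R r"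
  unfolding rho_def
proof (rule cINF_greatest)
  show "c\<^sup>2 \<le> \<bar>Phi_hat \<alpha> N y R r - 2 * of_int q\<bar>\<^sup>2" for q :: int
    by (rule power_mono[OF assms(2,1)])
qed simp

lemma rho_nonneg: "0 \<le> rho \<alpha> N y R r"
  using rho_ge[of 0 \<alpha> N y R r] by simp

lemma alphaN_le:
  assumes "p \<le> N - 2"
  shows "alphaN \<alpha> N \<le> \<bar>(2 * real p + 1) * \<alpha> - 2 * of_int q\<bar>"
proof -
  have "alphaN \<alpha> N \<le> (INF q::int. \<bar>(2 * real p + 1) * \<alpha> - 2 * of_int q\<bar>)"
    unfolding alphaN_def using assms by (intro Min_le) auto
  also have "\<dots> \<le> \<bar>(2 * real p + 1) * \<alpha> - 2 * of_int q\<bar>"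
    by (rule cINF_lower) (auto intro!: bdd_belowI[of _ 0])
  finally show ?thesis .
qed

lemma alphaN_nonneg: "0 \<le> alphaN \<alpha> N"
  unfolding alphaN_def by (subst Min_ge_iff) (auto intro!: cINF_greatest)

lemma alphaN_le_1: "alphaN \<alpha> N \<le> 1"
proof -
  \<comment> \<open>Witnesses: \<open>p = 0\<close> and an even integer nearest to
    \<open>\<alpha>\<close>.\<close>
  have "alphaN \<alpha> N \<le> \<bar>(2 * real 0 + 1) * \<alpha> - 2 * of_int (round (\<alpha> / 2))\<bar>" by (rule alphaN_le) simp
  also have "\<dots> = 2 * \<bar>of_int (round (\<alpha> / 2)) - \<alpha> / 2\<bar>" by (simp add: abs_if)
  also have "\<dots> \<le> 2 * (1 / 2)" by (intro mult_left_mono of_int_round_abs_le) simp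
  finally show ?thesis by simp
qed

text \<open>Passing to \<open>\<bar>\<alpha>\<bar>\<close> makes the flux nondecreasing in the
  radius; the change of sign maps even integers to even integers.\<close>

lemma alphaN_away:
  assumes "p \<le> N - 2"
  shows "alphaN \<alpha> N \<le> \<bar>\<bar>\<alpha>\<bar> * (1 + 2 * real p) - 2 * of_int k\<bar>"
proof (cases "0 \<le> \<alpha>")
  case True
  then show ?thesis using alphaN_le[OF assms, of \<alpha> k] by (simp add: algebra_simps)
next
  case False
  have "\<bar>\<bar>\<alpha>\<bar> * (1 + 2 * real p) - 2 * of_int k\<bar> = \<bar>(2 * real p + 1) * \<alpha> - 2 * of_int (- k)\<bar>"
    using False by (simp add: abs_if algebra_simps)
  then show ?thesis using alphaN_le[OF assms, of \<alpha> "- k"] by simp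
qed

section \<open>The energy inequality\<close>

text \<open>The theorem compares extended nonnegative integrals, the window estimates finite ones;
  this passes between the two.\<close>

lemma set_nn_integral_eq_ennreal_set_integral:
  fixes f :: "'a \<Rightarrow> real"
  assumes "set_integrable M S f" "\<And>x. x \<in> S \<Longrightarrow> 0 \<le> f x"
  shows "(\<integral>\<^sup>+ x\<in>S. ennreal (f x) \<partial>M) = ennreal (LINT x:S|M. f x)"
proof -
  have "(\<integral>\<^sup>+ x\<in>S. ennreal (f x) \<partial>M) = (\<integral>\<^sup>+ x. ennreal (indicator S x *\<^sub>R f x) \<partial>M)"
    by (rule nn_integral_cong) (auto simp: indicator_def)
  also have "\<dots> = ennreal (\<integral>x. indicator S x *\<^sub>R f x \<partial>M)"
    using assms by (intro nn_integral_eq_integral) (auto simp: set_integrable_def indicator_def)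
  finally show ?thesis by (simp add: set_lebesgue_integral_def)
qed

lemma nn_set_integral_mono_on:
  assumes "\<And>x. x \<in> S \<Longrightarrow> f x \<le> g x"
  shows "(\<integral>\<^sup>+ x\<in>S. f x \<partial>M) \<le> (\<integral>\<^sup>+ x\<in>S. g x \<partial>M)"
  by (rule nn_integral_mono) (auto simp: indicator_def assms)

text \<open>The square of \<open>c_const \<kappa>\<close> must absorb the constants 1014 and 3 of
  \<open>windows_bound\<close>: the first against the flux term \<open>(\<beta> / 130)^2\<close>,
  the second against the part \<open>\<kappa>\<close> of the energy of \<open>u'\<close>.\<close>

lemma c_const_bounds:
  assumes "0 \<le> \<kappa>" "\<kappa> \<le> 1"
  shows "(c_const \<kappa>)\<^sup>2 * 1014 \<le> 1 / 130\<^sup>2" "(c_const \<kappa>)\<^sup>2 * 3 \<le> \<kappa>"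
proof -
  have c0: "0 \<le> c_const \<kappa>" using assms by (simp add: c_const_def)
  \<comment> \<open>\<open>\<kappa> / (1 + 2 * \<kappa>)\<close> is at most \<open>1/3\<close>, and
    \<open>47/3 < 16\<close>.\<close>
  have "c_const \<kappa> \<le> 16 / 100000" using assms by (simp add: c_const_def field_simps)
  then have "(c_const \<kappa>)\<^sup>2 \<le> (16 / 100000)\<^sup>2" using c0 by (intro power_mono)
  then show "(c_const \<kappa>)\<^sup>2 * 1014 \<le> 1 / 130\<^sup>2" by (simp add: power2_eq_square)
  have "c_const \<kappa> \<le> 47 / 100000 * \<kappa>"
    unfolding c_const_def using assms by (intro divide_le_eq[THEN iffD2] ) (auto intro: mult_left_mono simp: algebra_simps)
  also have "\<dots> \<le> \<kappa> / 3" using assms by simp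
  finally have 1: "c_const \<kappa> \<le> \<kappa> / 3" .
  then have "c_const \<kappa> * c_const \<kappa> \<le> 1 * (\<kappa> / 3)" using c0 assms by (intro mult_mono) auto
  then show "(c_const \<kappa>)\<^sup>2 * 3 \<le> \<kappa>" by (simp add: power2_eq_square)
qed

text \<open>On \<open>G\<close> the flux is so far from the even integers that \<open>rho\<close> is
  at least \<open>(\<beta> / 130)^2\<close>; \<open>windows_bound\<close> spreads this over the
  whole interval at the cost of some energy of \<open>u'\<close>.\<close>

lemma flux_bound_positive_radius:
  fixes u u' :: "real \<Rightarrow> complex" and y :: "nat \<Rightarrow> real^2"
  assumes R: "0 < R" "R \<le> L / 6" and k: "0 \<le> \<kappa>" "\<kappa> \<le> 1"
    and u: "weighted_W12 R L u u'" and beta: "0 < alphaN \<alpha> N"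
  shows "(\<integral>\<^sup>+ r\<in>{R..L}. ennreal (((1 - \<kappa>) * (cmod (u' r))\<^sup>2 + (c_const \<kappa>)\<^sup>2 * (alphaN \<alpha> N)\<^sup>2 / r\<^sup>2
            * indicator {3*R..L-3*R} r * (cmod (u r))\<^sup>2) * r) \<partial>lborel)
    \<le> (\<integral>\<^sup>+ r\<in>{R..L}. ennreal (((cmod (u' r))\<^sup>2 + rho \<alpha> N y R r / r\<^sup>2 * (cmod (u r))\<^sup>2) * r) \<partial>lborel)"
proof -
  define \<beta> where "\<beta> = alphaN \<alpha> N"
  define P where "P = (\<lambda>r. \<bar>\<alpha>\<bar> * (1 + 2 * (\<Sum>l = 1..N-2. disk_share (y l) R (r\<^sup>2))))"
  define G where "G = {r \<in> {R..}. \<forall>k::int. \<beta> / 130 \<le> \<bar>P r - 2 * of_int k\<bar>}"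
  let ?w = "\<lambda>r. (cmod (u r))\<^sup>2 / r" and ?e = "\<lambda>r. (cmod (u' r))\<^sup>2 * r"
  let ?g = "\<lambda>r. indicator G r * ((cmod (u r))\<^sup>2 / r)"
  have b: "0 < \<beta>" "\<beta> \<le> 1" using beta alphaN_le_1 by (auto simp: \<beta>_def)
  have contP: "continuous_on UNIV P"
    unfolding P_def
    by (intro continuous_intros continuous_on_compose2[OF continuous_on_disk_share[OF R(1)]]) auto
  have G: "G \<in> sets borel"
  proof -
    have "G = {R..} \<inter> (\<Inter>k::int. {r. \<beta> / 130 \<le> \<bar>P r - 2 * of_int k\<bar>})" by (auto simp: G_def)
    also have "closed \<dots>"
      using contP by (intro closed_Int closed_INT ballI closed_Collect_le continuous_intros closed_atLeast)
    then have "{R..} \<inter> (\<Inter>k::int. {r. \<beta> / 130 \<le> \<bar>P r - 2 * of_int k\<bar>}) \<in> sets borel" by (rule borel_closed)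
    finally show ?thesis .
  qed
  \<comment> \<open>\<open>a >= R\<close> puts this stretch beyond \<open>7/4 R\<close>, as the
    density estimate requires.\<close>
  have dens: "R / 192 \<le> measure lborel (G \<inter> {a + 3/4 * R..a + R})" if "R \<le> a" for a
  proof -
    have "R / 192 \<le> measure lborel {r \<in> {(a + 3/4 * R)..(a + 3/4 * R) + R/4}. \<forall>k::int. \<beta> / 130 \<le> \<bar>P r - 2 * of_int k\<bar>}"
      unfolding P_def
      by (rule measure_flux_away_from_even_ge[OF R(1)]) (use that R b alphaN_away in \<open>auto simp: \<beta>_def\<close>)
    also have "{r \<in> {(a + 3/4 * R)..(a + 3/4 * R) + R/4}. \<forall>k::int. \<beta> / 130 \<le> \<bar>P r - 2 * of_int k\<bar>} = G \<inter> {a + 3/4 * R..a + R}"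
      using that R by (auto simp: G_def)
    finally show ?thesis .
  qed
  \<comment> \<open>\<open>R <= L / 6\<close> gives \<open>n >= 5\<close> windows of length
    \<open>R\<close>; stretching them to fill the interval costs a factor of at most
    \<open>(n + 1) / n <= 6/5\<close>.\<close>
  define n where "n = nat \<lfloor>(L - R) / R\<rfloor>"
  define l where "l = (L - R) / real n"
  have LR: "5 * R \<le> L - R" using R by simp
  then have "5 \<le> (L - R) / R" using R by (simp add: field_simps)
  then have f5: "5 \<le> \<lfloor>(L - R) / R\<rfloor>" by (simp add: le_floor_iff)
  then have nf: "real n = of_int \<lfloor>(L - R) / R\<rfloor>" by (simp add: n_def)
  have n5: "5 \<le> real n" "real n \<le> (L - R) / R" "(L - R) / R < real n + 1"
    using f5 floor_correct[of "(L - R) / R"] unfolding nf by auto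
  then have n0: "0 < real n" by linarith
  have nR: "real n * R \<le> L - R" "L - R \<le> (real n + 1) * R" using n5 R by (auto simp: field_simps)
  have l1: "R \<le> l" using nR n0 by (simp add: l_def pos_le_divide_eq mult.commute)
  have "(real n + 1) * R \<le> (6/5 * real n) * R" using n5 R by (intro mult_right_mono) auto
  also have "\<dots> = (6/5 * R) * real n" by simp
  finally have "L - R \<le> (6/5 * R) * real n" by (rule order_trans[OF nR(2)])
  then have l2: "l \<le> 6/5 * R" using n0 unfolding l_def by (simp only: pos_divide_le_eq)
  have L: "L = R + real n * l" using n0 by (simp add: l_def)
  have bound: "(LINT r:{R<..L}|lborel. ?w r) \<le> 1014 * (LINT r:{R<..L}|lborel. ?g r) + 3 * (LINT r:{R<..L}|lborel. ?e r)"
    by (rule windows_bound[OF R(1) l1 l2 L u G dens])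

  have ie0: "set_integrable lborel {R..L} ?e" using u unfolding weighted_W12_def by blast
  have iw0: "set_integrable lborel {R..L} ?w" by (rule weighted_W12_integrable_div[OF R(1) u])
  have ig0: "set_integrable lborel {R..L} (\<lambda>r. ?w r * indicator G r)"
    using G by (intro set_integrable_mult_bounded[OF iw0, where C = 1]) (auto simp: indicator_def)
  have sub: "{R<..L} \<subseteq> {R..L}" "{R<..L} \<in> sets lborel" by auto
  have iw: "set_integrable lborel {R<..L} ?w" and ie: "set_integrable lborel {R<..L} ?e"
    and ig: "set_integrable lborel {R<..L} ?g"
    using set_integrable_subset[OF iw0 sub(2,1)] set_integrable_subset[OF ie0 sub(2,1)]
      set_integrable_subset[OF ig0 sub(2,1)] by (auto simp: mult.commute)
  define q where "q = (c_const \<kappa>)\<^sup>2 * \<beta>\<^sup>2"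
  have q0: "0 \<le> q" by (simp add: q_def)
  have b2: "0 \<le> \<beta>\<^sup>2" "\<beta>\<^sup>2 \<le> 1" using b by (auto simp: power_le_one)
  have q1: "q * 1014 \<le> (\<beta> / 130)\<^sup>2"
    using mult_right_mono[OF c_const_bounds(1)[OF k] b2(1)] by (simp add: q_def power_divide mult_ac)
  have q2: "q * 3 \<le> \<kappa>"
  proof -
    have "q * 3 = ((c_const \<kappa>)\<^sup>2 * 3) * \<beta>\<^sup>2" by (simp add: q_def)
    also have "\<dots> \<le> ((c_const \<kappa>)\<^sup>2 * 3) * 1" using b2 by (intro mult_left_mono) auto
    finally show ?thesis using c_const_bounds(2)[OF k] by simp
  qed
  let ?I = "\<lambda>f. LINT r:{R<..L}|lborel. f r"
  have I0: "0 \<le> ?I ?g" "0 \<le> ?I ?e" using R by (auto intro!: set_integral_nonneg)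

  \<comment> \<open>The windows leave out the left end point, a null set.\<close>
  have "(\<integral>\<^sup>+ r\<in>{R..L}. ennreal (((1 - \<kappa>) * (cmod (u' r))\<^sup>2 + (c_const \<kappa>)\<^sup>2 * \<beta>\<^sup>2 / r\<^sup>2
            * indicator {3*R..L-3*R} r * (cmod (u r))\<^sup>2) * r) \<partial>lborel)
    = (\<integral>\<^sup>+ r\<in>{R<..L}. ennreal (((1 - \<kappa>) * (cmod (u' r))\<^sup>2 + (c_const \<kappa>)\<^sup>2 * \<beta>\<^sup>2 / r\<^sup>2
            * indicator {3*R..L-3*R} r * (cmod (u r))\<^sup>2) * r) \<partial>lborel)"
    by (rule nn_integral_cong_AE, use AE_lborel_singleton[of R] in eventually_elim) (auto simp: indicator_def)
  also have "\<dots> \<le> (\<integral>\<^sup>+ r\<in>{R<..L}. ennreal ((1 - \<kappa>) * ?e r + q * ?w r) \<partial>lborel)"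
  proof (rule nn_set_integral_mono_on)
    fix r assume r: "r \<in> {R<..L}"
    then have r0: "0 < r" using R by simp
    \<comment> \<open>The cutoff is estimated by 1.\<close>
    have "q / r\<^sup>2 * indicator {3*R..L-3*R} r * (cmod (u r))\<^sup>2 * r \<le> q / r\<^sup>2 * 1 * (cmod (u r))\<^sup>2 * r"
      using q0 r0 by (intro mult_right_mono mult_left_mono) (auto simp: indicator_def)
    also have "\<dots> = q * ?w r" using r0 by (simp add: power2_eq_square)
    finally show "ennreal (((1 - \<kappa>) * (cmod (u' r))\<^sup>2 + (c_const \<kappa>)\<^sup>2 * \<beta>\<^sup>2 / r\<^sup>2
            * indicator {3*R..L-3*R} r * (cmod (u r))\<^sup>2) * r) \<le> ennreal ((1 - \<kappa>) * ?e r + q * ?w r)"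
      by (intro ennreal_leI) (simp add: q_def distrib_right mult.assoc)
  qed
  also have "\<dots> = ennreal (?I (\<lambda>r. (1 - \<kappa>) * ?e r + q * ?w r))"
    using R k q0 ie iw
    by (intro set_nn_integral_eq_ennreal_set_integral set_integral_add(1) set_integrable_mult_right) auto
  also have "\<dots> \<le> ennreal (?I (\<lambda>r. ?e r + (\<beta> / 130)\<^sup>2 * ?g r))"
  proof (rule ennreal_leI)
    have "?I (\<lambda>r. (1 - \<kappa>) * ?e r + q * ?w r) = ?I (\<lambda>r. (1 - \<kappa>) * ?e r) + ?I (\<lambda>r. q * ?w r)"
      by (intro set_integral_add(2) set_integrable_mult_right ie iw)
    also have "\<dots> = (1 - \<kappa>) * ?I ?e + q * ?I ?w" by (simp only: set_integral_mult_right)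
    also have "q * ?I ?w \<le> q * (1014 * ?I ?g + 3 * ?I ?e)" by (rule mult_left_mono[OF bound q0])
    also have "\<dots> = (q * 1014) * ?I ?g + (q * 3) * ?I ?e" by (simp only: distrib_left mult.assoc)
    also have "\<dots> \<le> (\<beta> / 130)\<^sup>2 * ?I ?g + \<kappa> * ?I ?e"
      by (intro add_mono mult_right_mono q1 q2 I0)
    also have "(1 - \<kappa>) * ?I ?e + ((\<beta> / 130)\<^sup>2 * ?I ?g + \<kappa> * ?I ?e) = ?I ?e + (\<beta> / 130)\<^sup>2 * ?I ?g"
      by (simp add: left_diff_distrib)
    also have "\<dots> = ?I ?e + ?I (\<lambda>r. (\<beta> / 130)\<^sup>2 * ?g r)" by (simp only: set_integral_mult_right)
    also have "\<dots> = ?I (\<lambda>r. ?e r + (\<beta> / 130)\<^sup>2 * ?g r)"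
      by (intro set_integral_add(2)[symmetric] set_integrable_mult_right ie ig)
    finally show "?I (\<lambda>r. (1 - \<kappa>) * ?e r + q * ?w r) \<le> ?I (\<lambda>r. ?e r + (\<beta> / 130)\<^sup>2 * ?g r)" by simp
  qed
  also have "\<dots> = (\<integral>\<^sup>+ r\<in>{R<..L}. ennreal (?e r + (\<beta> / 130)\<^sup>2 * ?g r) \<partial>lborel)"
    using R ie ig
    by (intro set_nn_integral_eq_ennreal_set_integral[symmetric] set_integral_add(1) set_integrable_mult_right) auto
  also have "\<dots> \<le> (\<integral>\<^sup>+ r\<in>{R..L}. ennreal (((cmod (u' r))\<^sup>2 + rho \<alpha> N y R r / r\<^sup>2 * (cmod (u r))\<^sup>2) * r) \<partial>lborel)"
  proof (rule nn_integral_mono)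
    fix r
    show "ennreal (?e r + (\<beta> / 130)\<^sup>2 * ?g r) * indicator {R<..L} r
      \<le> ennreal (((cmod (u' r))\<^sup>2 + rho \<alpha> N y R r / r\<^sup>2 * (cmod (u r))\<^sup>2) * r) * indicator {R..L} r"
    proof (cases "r \<in> {R<..L}")
      case True
      then have r0: "0 < r" "R \<le> r" using R by auto
      have "(\<beta> / 130)\<^sup>2 * indicator G r \<le> rho \<alpha> N y R r"
      proof (cases "r \<in> G")
        case inG: True
        have "\<beta> / 130 \<le> \<bar>Phi_hat \<alpha> N y R r - 2 * of_int m\<bar>" for m :: int
        proof (cases "0 \<le> \<alpha>")
          case True
          have "\<beta> / 130 \<le> \<bar>P r - 2 * of_int m\<bar>" using inG unfolding G_def by blast
          then show ?thesis using True by (simp add: Phi_hat_eq_disk_share[OF R(1) r0(2)] P_def)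
        next
          case False
          have "\<beta> / 130 \<le> \<bar>P r - 2 * of_int (- m)\<bar>" using inG unfolding G_def by blast
          also have "P r - 2 * of_int (- m) = - (Phi_hat \<alpha> N y R r - 2 * of_int m)"
            using False by (simp add: Phi_hat_eq_disk_share[OF R(1) r0(2)] P_def)
          finally show ?thesis by (simp only: abs_minus_cancel)
        qed
        then show ?thesis using rho_ge[of "\<beta> / 130" \<alpha> N y R r] b inG by simp
      qed (use rho_nonneg in simp)
      then have "((\<beta> / 130)\<^sup>2 * indicator G r) * ?w r \<le> rho \<alpha> N y R r * ?w r"
        using r0 by (intro mult_right_mono) auto
      moreover have "rho \<alpha> N y R r * ?w r = rho \<alpha> N y R r / r\<^sup>2 * (cmod (u r))\<^sup>2 * r"
        using r0 by (simp add: power2_eq_square)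
      ultimately have "?e r + (\<beta> / 130)\<^sup>2 * ?g r \<le> ((cmod (u' r))\<^sup>2 + rho \<alpha> N y R r / r\<^sup>2 * (cmod (u r))\<^sup>2) * r"
        by (simp only: distrib_right mult.assoc)
      then show ?thesis using True by (auto intro: ennreal_leI)
    qed simp
  qed
  finally show ?thesis by (simp only: \<beta>_def)
qed

text \<open>The number of points enclosed is some \<open>p <= N - 2\<close>, so the flux is one of
  the values that enter \<open>alphaN\<close>.\<close>

lemma rho_ge_alphaN_zero_radius: "(alphaN \<alpha> N)\<^sup>2 \<le> rho \<alpha> N y 0 r"
proof (rule rho_ge[OF alphaN_nonneg])
  fix q :: int
  have "card {l \<in> {1..N-2}. norm (y l) < r} \<le> card {1..N-2}" by (intro card_mono) auto
  then have "card {l \<in> {1..N-2}. norm (y l) < r} \<le> N - 2" by simp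
  from alphaN_le[OF this, of \<alpha> q]
  show "alphaN \<alpha> N \<le> \<bar>Phi_hat \<alpha> N y 0 r - 2 * of_int q\<bar>"
    by (simp add: Phi_hat_def algebra_simps)
qed

theorem theorem4p1:
  fixes \<alpha> R L \<kappa> :: real and N :: nat and y :: "nat \<Rightarrow> real^2"
    and u u' :: "real \<Rightarrow> complex"
  assumes "N \<ge> 2" and "L > 0" and "0 \<le> R" and "R \<le> L / 6"
    and "0 \<le> \<kappa>" and "\<kappa> \<le> 1"
    and "weighted_W12 R L u u'"
  shows "(\<integral>\<^sup>+ r\<in>{R..L}. ennreal (((cmod (u' r))^2 + rho \<alpha> N y R r / r^2 * (cmod (u r))^2) * r) \<partial>lborel)
    \<ge> (\<integral>\<^sup>+ r\<in>{R..L}. ennreal (((1 - \<kappa>) * (cmod (u' r))^2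
          + (if R = 0 then 1 else c_const \<kappa>)^2 * (alphaN \<alpha> N)^2 / r^2
            * indicator {3*R..L-3*R} r * (cmod (u r))^2) * r) \<partial>lborel)"
proof (cases "R = 0 \<or> alphaN \<alpha> N = 0")
  case True
  \<comment> \<open>In both cases the integrands compare pointwise: \<open>K\<close> is
    \<open>(alphaN \<alpha> N)^2\<close>, a lower bound for \<open>rho\<close>, for point fluxes,
    and 0 when \<open>alphaN\<close> vanishes.\<close>
  define K where "K = (if R = 0 then 1 else c_const \<kappa>)\<^sup>2 * (alphaN \<alpha> N)\<^sup>2"
  have K: "0 \<le> K" "K \<le> rho \<alpha> N y R r" for r
    using True rho_ge_alphaN_zero_radius[of \<alpha> N y r] rho_nonneg[of \<alpha> N y R r] by (auto simp: K_def)
  show ?thesis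
    unfolding K_def[symmetric]
  proof (rule nn_set_integral_mono_on)
    fix r assume "r \<in> {R..L}"
    then have r: "0 \<le> r" using assms by simp
    have "K / r\<^sup>2 * indicator {3*R..L-3*R} r \<le> rho \<alpha> N y R r / r\<^sup>2"
      using K(1) K(2)[of r] by (auto simp: indicator_def divide_right_mono rho_nonneg)
    then have "K / r\<^sup>2 * indicator {3*R..L-3*R} r * (cmod (u r))\<^sup>2 \<le> rho \<alpha> N y R r / r\<^sup>2 * (cmod (u r))\<^sup>2"
      by (rule mult_right_mono) simp
    moreover have "(1 - \<kappa>) * (cmod (u' r))\<^sup>2 \<le> 1 * (cmod (u' r))\<^sup>2"
      using assms by (intro mult_right_mono) auto
    ultimately show "ennreal (((1 - \<kappa>) * (cmod (u' r))\<^sup>2 + K / r\<^sup>2 * indicator {3*R..L-3*R} r * (cmod (u r))\<^sup>2) * r)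
      \<le> ennreal (((cmod (u' r))\<^sup>2 + rho \<alpha> N y R r / r\<^sup>2 * (cmod (u r))\<^sup>2) * r)"
      using r by (intro ennreal_leI mult_right_mono) auto
  qed
next
  case False
  then show ?thesis
    using flux_bound_positive_radius[of R L \<kappa> u u' \<alpha> N y] assms alphaN_nonneg[of \<alpha> N] by simp
qed

end
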